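(* Let $s\in W$. For every solution $n_{ij}\in\mathbb{C}$, $i,j=1,\ldots,l$, of the equations $$d_jn_{ij}-d_in_{ji}=c_{ij},\qquad i,j=1,\ldots,l,$$ there exists an algebra isomorphism $\psi_{\{n\}}:U_h^{s}(\mathfrak g)\rightarrow U_h(\mathfrak g)$ given by the formulas $$\psi_{\{n\}}(e_i)=X_i^+\prod_{p=1}^lL_p^{n_{ip}},\qquad \psi_{\{n\}}(f_i)=\prod_{p=1}^lL_p^{-n_{ip}}X_i^-,\qquad \psi_{\{n\}}(H_i)=H_i ,\qquad i=1,\ldots,l.$$
   Context: Lie data. $\mathfrak g$ is a complex finite-dimensional simple Lie algebra, $\mathfrak h$ a Cartan subalgebra, $\Delta$ the root system, $W$ the Weyl group, $\alpha_1,\ldots,\alpha_l$ simple roots, $H_1,\ldots,H_l\in\mathfrak h$ the simple coroots, $a_{ij}=\alpha_j(H_i)$ the Cartan matrix; $d_1,\ldots,d_l$ are coprime positive integers such that $b_{ij}=d_ia_{ij}$ is symmetric. $(\cdot,\cdot)$ is the invariant symmetric bilinear form on $\mathfrak g$ with $(H_i,H_j)=d_j^{-1}a_{ij}$; it identifies $\mathfrak h\simeq\mathfrak h^*$ (with $\alpha_i\leftrightarrow d_iH_i$), and $(\alpha_i,\alpha_j)=b_{ij}$. For $s\in W$, $\mathfrak h'\subset\mathfrak h$ is the orthogonal complement to the subspace of $\mathfrak h$ fixed by $s$, $\mathfrak h'^*\subset\mathfrak h^*$ is its image under $\mathfrak h\simeq\mathfrak h^*$, and $P_{\mathfrak h'^*}$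 is the orthogonal projection of $\mathfrak h^*$ onto $\mathfrak h'^*$. Since $s$ has no nonzero fixed points in $\mathfrak h'^*$, the operator $\frac{1+s}{1-s}P_{\mathfrak h'^*}$ is well defined. Put $c_{ij}=\left(\frac{1+s}{1-s}P_{\mathfrak h'^*}\alpha_i,\alpha_j\right)$. Quantum group. $h$ is an indeterminate, $q=e^h$, $q_i=q^{d_i}$, $K_i=e^{d_ihH_i}$, $[n]_q=\frac{q^n-q^{-n}}{q-q^{-1}}$, $[n]_q!=[n]_q\cdots[1]_q$, $\left[{m\atop n}\right]_q=\frac{[m]_q!}{[n]_q![m-n]_q!}$. $U_h(\mathfrak g)$ is the algebra over $\mathbb C[[h]]$ topologically (in the $h$-adic topology) generated by $H_i,X_i^+,X_i^-$, $i=1,\ldots,l$, with relations $[H_i,H_j]=0$, $[H_i,X_j^\pm]=\pm a_{ij}X_j^\pm$, $X_i^+X_j^--X_j^-X_i^+=\delta_{ij}\frac{K_i-K_i^{-1}}{q_i-q_i^{-1}}$, and $\sum_{r=0}^{1-a_{ij}}(-1)^r\left[{1-a_{ij}\atop r}\right]_{q_i}(X_i^\pm)^{1-a_{ij}-r}X_j^\pm(X_i^\pm)^r=0$ for $i\ne j$. Put $Y_i=\sum_{j=1}^ld_i(a^{-1})_{ij}H_j$, $L_i=e^{hY_i}$, $L_i^{c}=e^{chY_i}$ for $c\in\mathbb C$. $U_h^{s}(\mathfrak g)$ is the associative algebra over $\mathbb C[[h]]$ topologically generated by $e_i,f_i,H_i$, $i=1,\ldots,l$, subject to: $[H_i,H_j]=0$,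 $[H_i,e_j]=a_{ij}e_j$, $[H_i,f_j]=-a_{ij}f_j$, $e_if_j-q^{-c_{ij}}f_je_i=\delta_{ij}\frac{K_i-K_i^{-1}}{q_i-q_i^{-1}}$ with $K_i=e^{d_ihH_i}$, and for $i\neq j$ $$\sum_{r=0}^{1-a_{ij}}(-1)^rq^{rc_{ij}}\left[{1-a_{ij}\atop r}\right]_{q_i}(e_i)^{1-a_{ij}-r}e_j(e_i)^r=0,\qquad \sum_{r=0}^{1-a_{ij}}(-1)^rq^{rc_{ij}}\left[{1-a_{ij}\atop r}\right]_{q_i}(f_i)^{1-a_{ij}-r}f_j(f_i)^r=0.$$ *)

theory Defs
  imports
    "HOL-Analysis.Elementary_Topology"
    "HOL-Analysis.Cartesian_Space"
    "HOL-Computational_Algebra.Formal_Power_Series"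
    "HOL-Library.Poly_Mapping"
    "HOL-Algebra.Module"
    "HOL-Algebra.QuotRing"
begin

section \<open>Simple Lie algebras, root systems, Weyl groups\<close>

locale complex_lie_algebra = vector_space scale
  for scale :: "complex \<Rightarrow> 'g::ab_group_add \<Rightarrow> 'g" (infixr \<open>*s\<close> 75) +
  fixes br :: "'g \<Rightarrow> 'g \<Rightarrow> 'g"
  assumes br_linear_left: "\<And>y. Vector_Spaces.linear scale scale (\<lambda>x. br x y)"
    and br_linear_right: "\<And>x. Vector_Spaces.linear scale scale (br x)"
    and br_alternating: "\<And>x. br x x = 0"
    and jacobi: "\<And>x y z. br x (br y z) + br y (br z x) + br z (br x y) = 0"
begin

definition lie_subalgebra :: "'g set \<Rightarrow> bool" where
  "lie_subalgebra A \<longleftrightarrow> subspace A \<and> (\<forall>x\<in>A. \<forall>y\<in>A. br x y \<in> A)"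

definition lie_ideal :: "'g set \<Rightarrow> bool" where
  "lie_ideal A \<longleftrightarrow> subspace A \<and> (\<forall>x. \<forall>y\<in>A. br x y \<in> A)"

definition simple_lie :: bool where
  "simple_lie \<longleftrightarrow> (\<exists>x y. br x y \<noteq> 0) \<and> (\<forall>A. lie_ideal A \<longrightarrow> A = {0} \<or> A = UNIV)"

definition finite_dim :: bool where
  "finite_dim \<longleftrightarrow> (\<exists>S. finite S \<and> span S = UNIV)"

fun lower_central :: "'g set \<Rightarrow> nat \<Rightarrow> 'g set" where
  "lower_central A 0 = A"
| "lower_central A (Suc n) = span {br x y | x y. x \<in> A \<and> y \<in> lower_central A n}"

definition normalizer :: "'g set \<Rightarrow> 'g set" where
  "normalizer A = {x. \<forall>y\<in>A. br x y \<in> A}"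

definition cartan_subalgebra :: "'g set \<Rightarrow> bool" where
  "cartan_subalgebra \<hh> \<longleftrightarrow>
     lie_subalgebra \<hh> \<and> (\<exists>n. lower_central \<hh> n = {0}) \<and> normalizer \<hh> = \<hh>"

text \<open>A functional on the subspace \<open>\<hh>\<close> is represented by the function on the whole type that
  extends it by \<open>0\<close> outside \<open>\<hh>\<close>; equality of functionals is then equality of functions.\<close>

definition dual_of :: "'g set \<Rightarrow> ('g \<Rightarrow> complex) set" where
  "dual_of \<hh> = {\<xi>. (\<forall>x\<in>\<hh>. \<forall>y\<in>\<hh>. \<xi> (x + y) = \<xi> x + \<xi> y) \<and>
                  (\<forall>c. \<forall>x\<in>\<hh>. \<xi> (c *s x) = c * \<xi> x) \<and> (\<forall>x. x \<notin> \<hh> \<longrightarrow> \<xi> x = 0)}"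

definition root_space :: "'g set \<Rightarrow> ('g \<Rightarrow> complex) \<Rightarrow> 'g set" where
  "root_space \<hh> \<beta> = {x. \<forall>y\<in>\<hh>. br y x = \<beta> y *s x}"

definition root_set :: "'g set \<Rightarrow> ('g \<Rightarrow> complex) set" where
  "root_set \<hh> = {\<beta> \<in> dual_of \<hh>. \<beta> \<noteq> (\<lambda>_. 0) \<and> root_space \<hh> \<beta> \<noteq> {0}}"

definition simple_roots :: "'g set \<Rightarrow> ('i::finite \<Rightarrow> 'g \<Rightarrow> complex) \<Rightarrow> bool" where
  "simple_roots \<hh> \<alpha> \<longleftrightarrow>
     range \<alpha> \<subseteq> root_set \<hh> \<and>
     (\<forall>\<xi>\<in>dual_of \<hh>. \<exists>!k::'i \<Rightarrow> complex. \<xi> = (\<lambda>x. \<Sum>i\<in>UNIV. k i * \<alpha> i x)) \<and>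
     (\<forall>\<beta>\<in>root_set \<hh>. \<exists>k::'i \<Rightarrow> int.
        ((\<forall>i. k i \<ge> 0) \<or> (\<forall>i. k i \<le> 0)) \<and> \<beta> = (\<lambda>x. \<Sum>i\<in>UNIV. of_int (k i) * \<alpha> i x))"

text \<open>The coroot of \<open>\<beta>\<close> is the unique \<open>t\<close> in \<open>[\<gg>\<^sub>\<beta>, \<gg>\<^sub>-\<^sub>\<beta>]\<close> with \<open>\<beta> t = 2\<close>.\<close>

definition is_coroot :: "'g set \<Rightarrow> ('g \<Rightarrow> complex) \<Rightarrow> 'g \<Rightarrow> bool" where
  "is_coroot \<hh> \<beta> t \<longleftrightarrow>
     t \<in> span {br x y | x y. x \<in> root_space \<hh> \<beta> \<and> y \<in> root_space \<hh> (\<lambda>z. - \<beta> z)} \<and> \<beta> t = 2"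

text \<open>The Weyl group acting on \<open>\<hh>\<close>. Since roots vanish outside \<open>\<hh>\<close>, its elements are
  bijections of the whole type which are the identity outside \<open>\<hh>\<close>.\<close>

inductive_set weyl_group :: "'g set \<Rightarrow> ('g \<Rightarrow> 'g) set" for \<hh> :: "'g set" where
  weyl_id: "(\<lambda>x. x) \<in> weyl_group \<hh>"
| weyl_reflection: "\<lbrakk>w \<in> weyl_group \<hh>; \<beta> \<in> root_set \<hh>; is_coroot \<hh> \<beta> t\<rbrakk>
    \<Longrightarrow> (\<lambda>x. w x - \<beta> (w x) *s t) \<in> weyl_group \<hh>"

end

text \<open>\<open>\<hh>\<close> a Cartan subalgebra, \<open>\<alpha>\<close> the simple roots, \<open>H\<close> the simple coroots, \<open>a\<close> the Cartan matrix,
  \<open>d\<close> its symmetrizer, \<open>B\<close> the normalized invariant form. The indices \<open>1, \<dots>, l\<close> are the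
  elements of the finite type \<open>'i\<close>.\<close>

locale lie_data = complex_lie_algebra scale br
  for scale :: "complex \<Rightarrow> 'g::ab_group_add \<Rightarrow> 'g" (infixr \<open>*s\<close> 75) and br :: "'g \<Rightarrow> 'g \<Rightarrow> 'g" +
  fixes \<hh> :: "'g set"
    and \<alpha> :: "'i::finite \<Rightarrow> 'g \<Rightarrow> complex"
    and H :: "'i \<Rightarrow> 'g"
    and a :: "'i \<Rightarrow> 'i \<Rightarrow> int"
    and d :: "'i \<Rightarrow> nat"
    and B :: "'g \<Rightarrow> 'g \<Rightarrow> complex"
  assumes simple: simple_lie
    and fin_dim: finite_dim
    and cartan: "cartan_subalgebra \<hh>"
    and simple_roots: "simple_roots \<hh> \<alpha>"
    and coroots: "\<And>i. is_coroot \<hh> (\<alpha> i) (H i)"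
    and cartan_matrix: "\<And>i j. of_int (a i j) = \<alpha> j (H i)"
    and d_pos: "\<And>i. d i > 0"
    and d_coprime: "Gcd (range d) = 1"
    and d_symmetrizes: "\<And>i j. int (d i) * a i j = int (d j) * a j i"
    and B_linear: "\<And>y. Vector_Spaces.linear scale (*) (\<lambda>x. B x y)"
    and B_symmetric: "\<And>x y. B x y = B y x"
    and B_invariant: "\<And>x y z. B (br x y) z = B x (br y z)"
    and B_normalized: "\<And>i j. B (H i) (H j) = of_int (a i j) / of_nat (d j)"
begin

definition to_dual :: "'g \<Rightarrow> 'g \<Rightarrow> complex" where
  "to_dual x = (\<lambda>y. if y \<in> \<hh> then B x y else 0)"

definition dual_form :: "('g \<Rightarrow> complex) \<Rightarrow> ('g \<Rightarrow> complex) \<Rightarrow> complex" where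
  "dual_form \<xi> \<mu> = B (inv_into \<hh> to_dual \<xi>) (inv_into \<hh> to_dual \<mu>)"

definition dual_action :: "('g \<Rightarrow> 'g) \<Rightarrow> ('g \<Rightarrow> complex) \<Rightarrow> 'g \<Rightarrow> complex" where
  "dual_action s \<xi> = (\<lambda>x. \<xi> (inv_into UNIV s x))"

definition h' :: "('g \<Rightarrow> 'g) \<Rightarrow> 'g set" where
  "h' s = {x \<in> \<hh>. \<forall>y\<in>\<hh>. s y = y \<longrightarrow> B x y = 0}"

definition h'_dual :: "('g \<Rightarrow> 'g) \<Rightarrow> ('g \<Rightarrow> complex) set" where
  "h'_dual s = to_dual ` h' s"

definition proj_h'_dual :: "('g \<Rightarrow> 'g) \<Rightarrow> ('g \<Rightarrow> complex) \<Rightarrow> 'g \<Rightarrow> complex" where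
  "proj_h'_dual s \<xi> =
     (THE \<mu>. \<mu> \<in> h'_dual s \<and> (\<forall>\<nu>\<in>h'_dual s. dual_form (\<lambda>x. \<xi> x - \<mu> x) \<nu> = 0))"

text \<open>\<open>(1 + s) (1 - s)\<^sup>-\<^sup>1\<close>, the inverse being that of the restriction of \<open>1 - s\<close> to \<open>h'_dual s\<close>.\<close>

definition cayley :: "('g \<Rightarrow> 'g) \<Rightarrow> ('g \<Rightarrow> complex) \<Rightarrow> 'g \<Rightarrow> complex" where
  "cayley s \<mu> =
     (let \<rho> = inv_into (h'_dual s) (\<lambda>\<nu> x. \<nu> x - dual_action s \<nu> x) \<mu>
      in (\<lambda>x. \<rho> x + dual_action s \<rho> x))"

definition cayley_coeff :: "('g \<Rightarrow> 'g) \<Rightarrow> 'i \<Rightarrow> 'i \<Rightarrow> complex" where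
  "cayley_coeff s i j = dual_form (cayley s (proj_h'_dual s (\<alpha> i))) (\<alpha> j)"

end


section \<open>Topologically presented algebras over the formal power series ring\<close>

text \<open>The free monoid on \<open>'x\<close>, written additively so that its monoid algebra is available as a
  type of polynomial mappings.\<close>

datatype 'x word = Word (letters: "'x list")

instantiation word :: (type) monoid_add
begin

definition zero_word :: "'a word" where
  "0 = Word []"

definition plus_word :: "'a word \<Rightarrow> 'a word \<Rightarrow> 'a word" where
  "u + v = Word (letters u @ letters v)"

instance
  by standard (simp_all add: zero_word_def plus_word_def)

end

text \<open>\<open>'x free_alg\<close> is the free associative algebra \<open>\<complex>\<langle>x\<rangle>\<close>, and \<open>'x free_alg fps\<close> is the \<open>h\<close>-adic
  completion \<open>\<complex>\<langle>x\<rangle>[[h]]\<close> of the free \<open>\<complex>[[h]]\<close>-algebra. The library topology on power series is the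
  \<open>h\<close>-adic one.\<close>

type_synonym 'x free_alg = "'x word \<Rightarrow>\<^sub>0 complex"

definition cst :: "complex \<Rightarrow> 'x free_alg" where
  "cst c = Poly_Mapping.single 0 c"

definition gen :: "'x \<Rightarrow> 'x free_alg" where
  "gen x = Poly_Mapping.single (Word [x]) 1"

definition gen_fps :: "'x \<Rightarrow> 'x free_alg fps" where
  "gen_fps x = fps_const (gen x)"

definition scal :: "complex fps \<Rightarrow> 'x free_alg fps \<Rightarrow> 'x free_alg fps" (infixr \<open>*h\<close> 75) where
  "f *h x = Abs_fps (\<lambda>n. cst (fps_nth f n)) * x"

text \<open>\<open>e\<^sup>h\<^sup>u\<close>\<close>
definition hexp :: "'x free_alg \<Rightarrow> 'x free_alg fps" where
  "hexp u = Abs_fps (\<lambda>n. cst (1 / fact n) * u ^ n)"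

definition free_ring :: "'x free_alg fps ring" where
  "free_ring = \<lparr>carrier = UNIV, monoid.mult = (*), one = 1, zero = 0, add = (+)\<rparr>"

definition rel_ideal :: "'x free_alg fps set \<Rightarrow> 'x free_alg fps set" where
  "rel_ideal R = closure (genideal free_ring R)"

definition cls :: "'x free_alg fps set \<Rightarrow> 'x free_alg fps \<Rightarrow> 'x free_alg fps set" where
  "cls R x = rel_ideal R +>\<^bsub>free_ring\<^esub> x"

text \<open>The algebra topologically generated by \<open>'x\<close> subject to the relations \<open>r = 0\<close>, \<open>r \<in> R\<close>; the
  scalar product of \<open>f\<close> with the class of \<open>x\<close> is the class of \<open>f *h x\<close>.\<close>

definition presented_alg :: "'x free_alg fps set \<Rightarrow> (complex fps, 'x free_alg fps set) module" where
  "presented_alg R =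
     ring.extend (free_ring Quot rel_ideal R)
       (module.fields (\<lambda>f X. \<Union>x\<in>X. cls R (f *h x)))"

definition alg_iso ::
  "('k, 'a) module \<Rightarrow> ('k, 'b) module \<Rightarrow> ('a \<Rightarrow> 'b) set" where
  "alg_iso A C =
     {\<psi> \<in> ring_iso A C. \<forall>f. \<forall>x\<in>carrier A. \<psi> (f \<odot>\<^bsub>A\<^esub> x) = f \<odot>\<^bsub>C\<^esub> \<psi> x}"


section \<open>Quantum groups\<close>

text \<open>The library quotient of power series over a field is the exact quotient whenever the latter
  exists, also for divisors divisible by \<open>h\<close>.\<close>

definition q_int :: "complex fps \<Rightarrow> nat \<Rightarrow> complex fps" where
  "q_int q n = (q ^ n - inverse q ^ n) / (q - inverse q)"

definition q_fact :: "complex fps \<Rightarrow> nat \<Rightarrow> complex fps" where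
  "q_fact q n = (\<Prod>k=1..n. q_int q k)"

definition q_binom :: "complex fps \<Rightarrow> nat \<Rightarrow> nat \<Rightarrow> complex fps" where
  "q_binom q m n = q_fact q m / (q_fact q n * q_fact q (m - n))"

text \<open>\<open>qpow c\<close> is \<open>q\<^sup>c = e\<^sup>c\<^sup>h\<close> for \<open>q = e\<^sup>h\<close> and complex \<open>c\<close>.\<close>
definition qpow :: "complex \<Rightarrow> complex fps" where
  "qpow c = fps_exp c"

text \<open>\<open>E i\<close> stands for \<open>X\<^sub>i\<^sup>+\<close> resp. \<open>e\<^sub>i\<close>, \<open>F i\<close> for \<open>X\<^sub>i\<^sup>-\<close> resp. \<open>f\<^sub>i\<close>.\<close>
datatype 'i generator = E 'i | F 'i | Hgen 'i

abbreviation gE :: "'i \<Rightarrow> 'i generator free_alg fps" where "gE i \<equiv> gen_fps (E i)"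
abbreviation gF :: "'i \<Rightarrow> 'i generator free_alg fps" where "gF i \<equiv> gen_fps (F i)"
abbreviation gH :: "'i \<Rightarrow> 'i generator free_alg fps" where "gH i \<equiv> gen_fps (Hgen i)"

definition qi :: "('i \<Rightarrow> nat) \<Rightarrow> 'i \<Rightarrow> complex fps" where
  "qi d i = qpow 1 ^ d i"

definition Kpos :: "('i \<Rightarrow> nat) \<Rightarrow> 'i \<Rightarrow> 'i generator free_alg fps" where
  "Kpos d i = hexp (cst (of_nat (d i)) * gen (Hgen i))"

definition Kneg :: "('i \<Rightarrow> nat) \<Rightarrow> 'i \<Rightarrow> 'i generator free_alg fps" where
  "Kneg d i = hexp (cst (- of_nat (d i)) * gen (Hgen i))"

text \<open>\<open>(K\<^sub>i - K\<^sub>i\<^sup>-\<^sup>1) / (q\<^sub>i - q\<^sub>i\<^sup>-\<^sup>1)\<close>: numerator and denominator are both divided by \<open>h\<close>, which makes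
  the denominator invertible; see \<open>Kquot_eq\<close>.\<close>
definition Kquot :: "('i \<Rightarrow> nat) \<Rightarrow> 'i \<Rightarrow> 'i generator free_alg fps" where
  "Kquot d i = inverse (fps_shift 1 (qi d i - inverse (qi d i))) *h fps_shift 1 (Kpos d i - Kneg d i)"

definition Uh_rels ::
  "('i \<Rightarrow> 'i \<Rightarrow> int) \<Rightarrow> ('i \<Rightarrow> nat) \<Rightarrow> 'i generator free_alg fps set" where
  "Uh_rels a d =
     {gH i * gH j - gH j * gH i | i j. True} \<union>
     {gH i * gE j - gE j * gH i - of_int (a i j) *h gE j | i j. True} \<union>
     {gH i * gF j - gF j * gH i + of_int (a i j) *h gF j | i j. True} \<union>
     {gE i * gF j - gF j * gE i - (if i = j then Kquot d i else 0) | i j. True} \<union>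
     {(\<Sum>r\<le>nat (1 - a i j). ((-1) ^ r * q_binom (qi d i) (nat (1 - a i j)) r) *h
         (gE i ^ (nat (1 - a i j) - r) * gE j * gE i ^ r)) | i j. i \<noteq> j} \<union>
     {(\<Sum>r\<le>nat (1 - a i j). ((-1) ^ r * q_binom (qi d i) (nat (1 - a i j)) r) *h
         (gF i ^ (nat (1 - a i j) - r) * gF j * gF i ^ r)) | i j. i \<noteq> j}"

definition Uhs_rels ::
  "('i \<Rightarrow> 'i \<Rightarrow> int) \<Rightarrow> ('i \<Rightarrow> nat) \<Rightarrow> ('i \<Rightarrow> 'i \<Rightarrow> complex) \<Rightarrow> 'i generator free_alg fps set" where
  "Uhs_rels a d c =
     {gH i * gH j - gH j * gH i | i j. True} \<union>
     {gH i * gE j - gE j * gH i - of_int (a i j) *h gE j | i j. True} \<union>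
     {gH i * gF j - gF j * gH i + of_int (a i j) *h gF j | i j. True} \<union>
     {gE i * gF j - qpow (- c i j) *h (gF j * gE i) - (if i = j then Kquot d i else 0) | i j. True} \<union>
     {(\<Sum>r\<le>nat (1 - a i j).
         ((-1) ^ r * qpow (of_nat r * c i j) * q_binom (qi d i) (nat (1 - a i j)) r) *h
         (gE i ^ (nat (1 - a i j) - r) * gE j * gE i ^ r)) | i j. i \<noteq> j} \<union>
     {(\<Sum>r\<le>nat (1 - a i j).
         ((-1) ^ r * qpow (of_nat r * c i j) * q_binom (qi d i) (nat (1 - a i j)) r) *h
         (gF i ^ (nat (1 - a i j) - r) * gF j * gF i ^ r)) | i j. i \<noteq> j}"

abbreviation Uh where "Uh a d \<equiv> presented_alg (Uh_rels a d)"
abbreviation Uhs where "Uhs a d c \<equiv> presented_alg (Uhs_rels a d c)"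

definition Y ::
  "('i::finite \<Rightarrow> 'i \<Rightarrow> int) \<Rightarrow> ('i \<Rightarrow> nat) \<Rightarrow> 'i \<Rightarrow> 'i generator free_alg" where
  "Y a d i = (\<Sum>j\<in>UNIV. cst (of_nat (d i) *
     vec_nth (vec_nth (matrix_inv (\<chi> k m. of_int (a k m))) i) j) * gen (Hgen j))"

text \<open>\<open>Lpow a d i c\<close> is \<open>L\<^sub>i\<^sup>c = e\<^sup>c\<^sup>h\<^sup>Y\<close> with \<open>Y = Y\<^sub>i\<close>.\<close>
definition Lpow ::
  "('i::finite \<Rightarrow> 'i \<Rightarrow> int) \<Rightarrow> ('i \<Rightarrow> nat) \<Rightarrow> 'i \<Rightarrow> complex \<Rightarrow> 'i generator free_alg fps" where
  "Lpow a d i c = hexp (cst c * Y a d i)"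

text \<open>\<open>Lprod a d m\<close> is the product over \<open>p = 1, \<dots>, l\<close>, in this order, of the \<open>L\<^sub>p\<close> to the power
  \<open>m p\<close>.\<close>
definition Lprod ::
  "('i::{finite,linorder} \<Rightarrow> 'i \<Rightarrow> int) \<Rightarrow> ('i \<Rightarrow> nat) \<Rightarrow> ('i \<Rightarrow> complex) \<Rightarrow>
     'i generator free_alg fps" where
  "Lprod a d m = prod_list (map (\<lambda>p. Lpow a d p (m p)) (sorted_list_of_set UNIV))"

lemma cst_mult: "cst (x * y) = cst x * cst y"
  by (simp add: cst_def mult_single)

lemma cst_add: "cst (x + y) = cst x + cst y"
  by (simp add: cst_def single_add)

lemma scal_assoc: "(f * g) *h x = f *h (g *h x)"
proof -
  have 0: "cst 0 = 0" by (simp add: cst_def)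
  have cst_sum: "cst (sum u A) = (\<Sum>i\<in>A. cst (u i))" if "finite A" for u :: "nat \<Rightarrow> complex" and A
    using that by (induction A rule: finite_induct) (simp_all add: cst_add 0)
  have "Abs_fps (\<lambda>n. cst (fps_nth (f * g) n) :: 'a free_alg) =
      Abs_fps (\<lambda>n. cst (fps_nth f n)) * Abs_fps (\<lambda>n. cst (fps_nth g n))"
    by (simp add: fps_eq_iff fps_mult_nth cst_sum cst_mult)
  then show ?thesis by (simp add: scal_def mult.assoc)
qed

lemma Kquot_eq:
  assumes "d i > 0"
  shows "(qi d i - inverse (qi d i)) *h Kquot d i = Kpos d i - Kneg d i"
proof -
  define f where "f = qi d i - inverse (qi d i)"
  define x where "x = Kpos d i - Kneg d i"
  have q: "qi d i = fps_exp (of_nat (d i))"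
    by (simp add: qi_def qpow_def fps_exp_power_mult)
  have f: "f = fps_exp (of_nat (d i)) - fps_exp (- of_nat (d i))"
    by (simp add: f_def q fps_exp_neg)
  have f0: "fps_nth f 0 = 0" and f1: "fps_nth f 1 \<noteq> 0"
    using assms by (simp_all add: f)
  have x0: "fps_nth x 0 = 0"
    by (simp add: x_def Kpos_def Kneg_def hexp_def)
  have "f = fps_shift 1 f * fps_X"
    using f0 by (simp add: fps_eq_iff)
  moreover have "fps_shift 1 f * inverse (fps_shift 1 f) = 1"
    using f1 by (intro inverse_mult_eq_1') simp
  ultimately have *: "f * inverse (fps_shift 1 f) = fps_X"
    by (metis mult.assoc mult.commute mult.right_neutral)
  have "Abs_fps (\<lambda>n. cst (fps_nth fps_X n)) = (fps_X :: 'a generator free_alg fps)"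
    by (simp add: fps_eq_iff cst_def fps_X_def)
  then have "fps_X *h fps_shift 1 x = fps_X * fps_shift 1 x"
    by (simp only: scal_def)
  also have "\<dots> = x"
    using x0 by (simp add: fps_eq_iff)
  finally have "fps_X *h fps_shift 1 x = x" .
  then show ?thesis
    unfolding Kquot_def f_def[symmetric] x_def[symmetric] scal_assoc[symmetric] * .
qed

end

theory Submission
  imports Defs "HOL-Analysis.Elementary_Metric_Spaces"
begin

text \<open>Both algebras are quotients of the same completed free algebra. With \<open>T\<^sub>i = \<Prod>\<^sub>p L\<^sub>p\<close> to the power
  \<open>n\<^sub>i\<^sub>p\<close>, the substitution \<open>e\<^sub>i \<mapsto> X\<^sub>i\<^sup>+ T\<^sub>i\<close>, \<open>f\<^sub>i \<mapsto> T\<^sub>i\<^sup>-\<^sup>1 X\<^sub>i\<^sup>-\<close>, \<open>H\<^sub>i \<mapsto> H\<^sub>i\<close> extends to a continuous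
  automorphism of that free algebra, because \<open>T\<^sub>i\<close> only involves the \<open>H\<^sub>j\<close> and the exponentials are
  invertible there before any relation is imposed; the inverse is a substitution of the same kind. Modulo
  the relations, \<open>T\<^sub>i\<close> commutes with the generators of index \<open>k\<close> up to \<open>q\<close> to the power
  \<open>t\<^sub>i\<^sub>k = d\<^sub>k n\<^sub>i\<^sub>k\<close>, by invertibility of the Cartan matrix. Moving every \<open>T\<close> to the right
  therefore turns the relations with parameter \<open>c\<close> into those with parameter \<open>c\<^sub>i\<^sub>j - t\<^sub>i\<^sub>j + t\<^sub>j\<^sub>i\<close>, up to an
  invertible factor. Hence the substitution maps one closed ideal of relations onto the other.\<close>

section \<open>Scalars and closed ideals\<close>

text \<open>Through this embedding, scalar multiplication \<open>*h\<close> becomes multiplication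
  by a central element, so that ring identities apply to it directly.\<close>

definition emb :: "complex fps \<Rightarrow> 'x free_alg fps" where
  "emb f = Abs_fps (\<lambda>n. cst (fps_nth f n))"

lemma cst_0 [simp]: "cst 0 = 0" and cst_1 [simp]: "cst 1 = 1"
  by (simp_all add: cst_def)

lemma cst_diff: "cst (x - y) = cst x - cst y"
  by (simp add: cst_def single_diff)

lemma cst_sum: "cst (sum u A) = (\<Sum>i\<in>A. cst (u i))"
  by (induction A rule: infinite_finite_induct) (simp_all add: cst_add)

lemma sum_singles: "p = (\<Sum>w\<in>Poly_Mapping.keys p. Poly_Mapping.single w (Poly_Mapping.lookup p w))"
  by (rule poly_mapping_eqI) (simp add: lookup_sum lookup_single when_def in_keys_iff)

lemma poly_mapping_single_induct [case_names zero add single]: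
  assumes "P 0" "\<And>p q. P p \<Longrightarrow> P q \<Longrightarrow> P (p + q)" "\<And>w c. P (Poly_Mapping.single w c)"
  shows "P (p :: 'a \<Rightarrow>\<^sub>0 'b::comm_monoid_add)"
proof -
  have "P (\<Sum>w\<in>A. Poly_Mapping.single w (g w))" if "finite A" for A g
    using that by induction (auto intro: assms)
  then show ?thesis by (subst sum_singles) simp
qed

lemma cst_commute: "cst c * p = p * cst c"
  by (induction p rule: poly_mapping_single_induct)
    (simp_all add: distrib_left distrib_right cst_def mult_single mult.commute)

lemma fps_nth_emb [simp]: "fps_nth (emb f) n = cst (fps_nth f n)"
  by (simp add: emb_def)

lemma scal_emb: "f *h x = emb f * x"
  by (simp add: scal_def emb_def)

lemma emb_0 [simp]: "emb 0 = 0" and emb_1 [simp]: "emb 1 = 1"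
  and emb_add: "emb (f + g) = emb f + emb g"
  and emb_diff: "emb (f - g) = emb f - emb g"
  and emb_mult: "emb (f * g) = emb f * emb g"
  by (simp_all add: fps_eq_iff cst_add cst_diff fps_mult_nth cst_sum cst_mult)

lemma emb_minus: "emb (- f) = - emb f"
  using emb_diff[of 0 f] by simp

lemma emb_fps_const: "emb (fps_const c) = fps_const (cst c)"
  by (simp add: fps_eq_iff)

lemma emb_fps_X: "emb fps_X = fps_X"
  by (simp add: fps_eq_iff fps_X_def)

lemma emb_power: "emb (f ^ n) = emb f ^ n"
  by (induction n) (simp_all add: emb_mult)

text \<open>Constants are central in the free algebra, and reversing the summation index matches the
  two convolutions.\<close>

lemma emb_commute: "emb f * x = x * emb f"
proof (rule fps_ext)
  fix n
  have "fps_nth (x * emb f) n = (\<Sum>i = 0..n. fps_nth x (n - i) * cst (fps_nth f i))"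
    unfolding fps_mult_nth fps_nth_emb by (subst sum.atLeastAtMost_rev) simp
  then show "fps_nth (emb f * x) n = fps_nth (x * emb f) n"
    by (simp add: fps_mult_nth cst_commute)
qed

lemma emb_left_commute: "x * (emb f * y) = emb f * (x * y)"
  by (metis emb_commute mult.assoc)

text \<open>The last clause expresses closedness in the h-adic topology; closure under negation
  follows from multiplication by -1.\<close>

definition closed_ideal :: "'x free_alg fps set \<Rightarrow> bool" where
  "closed_ideal J \<longleftrightarrow> 0 \<in> J \<and> (\<forall>x\<in>J. \<forall>y\<in>J. x + y \<in> J) \<and> (\<forall>x\<in>J. \<forall>y. y * x \<in> J \<and> x * y \<in> J) \<and>
     (\<forall>x. (\<forall>N. \<exists>y\<in>J. \<forall>n\<le>N. fps_nth x n = fps_nth y n) \<longrightarrow> x \<in> J)"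

lemma closed_idealD:
  assumes "closed_ideal J"
  shows "0 \<in> J" "x \<in> J \<Longrightarrow> y \<in> J \<Longrightarrow> x + y \<in> J" "x \<in> J \<Longrightarrow> y * x \<in> J" "x \<in> J \<Longrightarrow> x * y \<in> J"
    "(\<And>N. \<exists>y\<in>J. \<forall>n\<le>N. fps_nth x n = fps_nth y n) \<Longrightarrow> x \<in> J"
  using assms unfolding closed_ideal_def by blast+

lemma closed_ideal_minus: "closed_ideal J \<Longrightarrow> x \<in> J \<Longrightarrow> - x \<in> J"
  using closed_idealD(3)[of J x "- 1"] by simp

lemma closed_ideal_diff: "closed_ideal J \<Longrightarrow> x \<in> J \<Longrightarrow> y \<in> J \<Longrightarrow> x - y \<in> J"
  using closed_idealD(2)[of J x "- y"] closed_ideal_minus[of J y] by simp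

section \<open>The ideal of relations as the smallest closed ideal\<close>

lemma free_ring_simps [simp]:
  "carrier free_ring = UNIV" "x \<otimes>\<^bsub>free_ring\<^esub> y = x * y" "x \<oplus>\<^bsub>free_ring\<^esub> y = x + y"
  "\<one>\<^bsub>free_ring\<^esub> = 1" "\<zero>\<^bsub>free_ring\<^esub> = 0"
  by (simp_all add: free_ring_def)

lemma ring_free_ring: "ring free_ring"
proof (rule ringI)
  show "abelian_group free_ring"
    by (rule abelian_groupI) (auto simp: add_ac, metis add.right_inverse)
  show "monoid free_ring"
    by (rule monoidI) (auto simp: mult.assoc)
qed (simp_all add: distrib_left distrib_right)

lemma minus_free_ring [simp]: "\<ominus>\<^bsub>free_ring\<^esub> x = - x"
  using abelian_group.minus_equality[OF ring.is_abelian_group[OF ring_free_ring], of "- x" x] by simp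

lemma ideal_free_ring_iff:
  "ideal I free_ring \<longleftrightarrow> 0 \<in> I \<and> (\<forall>x\<in>I. \<forall>y\<in>I. x + y \<in> I) \<and> (\<forall>x\<in>I. \<forall>y. y * x \<in> I \<and> x * y \<in> I)"
  (is "?L \<longleftrightarrow> ?R")
proof
  assume ?L
  then interpret ideal I free_ring .
  show ?R
    using additive_subgroup.zero_closed[OF additive_subgroup_axioms]
      additive_subgroup.a_closed[OF additive_subgroup_axioms] I_l_closed I_r_closed by simp
next
  assume R: ?R
  interpret ring free_ring by (rule ring_free_ring)
  have "- x \<in> I" if "x \<in> I" for x
    using R that mult_minus1[of x] by metis
  with R have "subgroup I (add_monoid free_ring)"
    by (intro add.subgroupI) (auto simp flip: a_inv_def)
  with R show ?L
    by (intro idealI ring_free_ring) auto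
qed

text \<open>Two series are at distance less than \<open>inverse (2 ^ N)\<close> exactly if they
  agree up to index \<open>N\<close>, and these radii are arbitrarily small.\<close>

lemma closure_fps_iff:
  "(x :: 'a::group_add fps) \<in> closure S \<longleftrightarrow> (\<forall>N. \<exists>y\<in>S. \<forall>n\<le>N. fps_nth x n = fps_nth y n)"
proof -
  have "x \<in> closure S \<longleftrightarrow> (\<forall>N. \<exists>y\<in>S. dist y x < inverse (2 ^ N))"
  proof
    assume R: "\<forall>N. \<exists>y\<in>S. dist y x < inverse (2 ^ N)"
    show "x \<in> closure S" unfolding closure_approachable
    proof (intro allI impI)
      fix e :: real assume "e > 0"
      then obtain N where "inverse (2 ^ N) < e"
        using real_arch_pow_inv[of e "1/2"] by (auto simp: power_divide inverse_eq_divide)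
      with R show "\<exists>y\<in>S. dist y x < e" by (meson less_trans)
    qed
  qed (simp add: closure_approachable)
  then show ?thesis unfolding dist_less_eq_nth_equal by metis
qed

lemma ideal_genideal: "ideal (genideal free_ring R) free_ring"
  by (rule ring.genideal_ideal[OF ring_free_ring]) simp

lemma rel_ideal_iff:
  "x \<in> rel_ideal R \<longleftrightarrow> (\<forall>N. \<exists>y\<in>genideal free_ring R. \<forall>n\<le>N. fps_nth x n = fps_nth y n)"
  by (simp add: rel_ideal_def closure_fps_iff)

text \<open>Coefficients up to \<open>N\<close> of sums and products depend only on coefficients up
  to \<open>N\<close> of the arguments, so approximants from the generated ideal can be added and
  multiplied. Closing once more adds nothing, since agreement up to \<open>N\<close> is
  transitive.\<close>

lemma closed_ideal_rel_ideal: "closed_ideal (rel_ideal R)"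
proof -
  let ?G = "genideal free_ring R"
  note G = ideal_genideal[of R, unfolded ideal_free_ring_iff]
  show ?thesis unfolding closed_ideal_def
  proof (intro conjI ballI allI impI)
    show "0 \<in> rel_ideal R" unfolding rel_ideal_iff using G by blast
    show "x + y \<in> rel_ideal R" if "x \<in> rel_ideal R" "y \<in> rel_ideal R" for x y
      unfolding rel_ideal_iff
    proof
      fix N
      obtain u v where "u \<in> ?G" "v \<in> ?G" "\<forall>n\<le>N. fps_nth x n = fps_nth u n"
        "\<forall>n\<le>N. fps_nth y n = fps_nth v n" using \<open>x \<in> rel_ideal R\<close> \<open>y \<in> rel_ideal R\<close>
        unfolding rel_ideal_iff by meson
      then show "\<exists>z\<in>?G. \<forall>n\<le>N. fps_nth (x + y) n = fps_nth z n"
        using G by (intro bexI[of _ "u + v"]) auto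
    qed
    show "y * x \<in> rel_ideal R" if "x \<in> rel_ideal R" for x y
      unfolding rel_ideal_iff
    proof
      fix N
      obtain u where "u \<in> ?G" "\<forall>n\<le>N. fps_nth x n = fps_nth u n"
        using \<open>x \<in> rel_ideal R\<close> unfolding rel_ideal_iff by blast
      then show "\<exists>z\<in>?G. \<forall>n\<le>N. fps_nth (y * x) n = fps_nth z n"
        using G by (intro bexI[of _ "y * u"]) (auto simp: fps_mult_nth)
    qed
    show "x * y \<in> rel_ideal R" if "x \<in> rel_ideal R" for x y
      unfolding rel_ideal_iff
    proof
      fix N
      obtain u where "u \<in> ?G" "\<forall>n\<le>N. fps_nth x n = fps_nth u n"
        using \<open>x \<in> rel_ideal R\<close> unfolding rel_ideal_iff by blast
      then show "\<exists>z\<in>?G. \<forall>n\<le>N. fps_nth (x * y) n = fps_nth z n"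
        using G by (intro bexI[of _ "u * y"]) (auto simp: fps_mult_nth)
    qed
    show "x \<in> rel_ideal R" if x: "\<forall>N. \<exists>y\<in>rel_ideal R. \<forall>n\<le>N. fps_nth x n = fps_nth y n" for x
      unfolding rel_ideal_iff
    proof
      fix N
      obtain y where y: "y \<in> rel_ideal R" "\<forall>n\<le>N. fps_nth x n = fps_nth y n" using x by blast
      then obtain z where "z \<in> ?G" "\<forall>n\<le>N. fps_nth y n = fps_nth z n"
        unfolding rel_ideal_iff by blast
      with y show "\<exists>z\<in>?G. \<forall>n\<le>N. fps_nth x n = fps_nth z n" by auto
    qed
  qed
qed

lemma rel_ideal_superset: "R \<subseteq> rel_ideal R"
  using ring.genideal_self[OF ring_free_ring, of R] closure_subset unfolding rel_ideal_def by fastforce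

text \<open>A closed ideal containing \<open>R\<close> contains the algebraically generated ideal
  and then all its limits. Inclusions of relation ideals thereby reduce to the relations
  themselves.\<close>

lemma rel_ideal_least:
  assumes "closed_ideal I" "R \<subseteq> I"
  shows "rel_ideal R \<subseteq> I"
proof
  fix x assume "x \<in> rel_ideal R"
  have "ideal I free_ring"
    using assms(1) by (simp add: ideal_free_ring_iff closed_idealD)
  then have "genideal free_ring R \<subseteq> I"
    using ring.genideal_minimal[OF ring_free_ring] assms(2) by blast
  then show "x \<in> I"
    using \<open>x \<in> rel_ideal R\<close> unfolding rel_ideal_iff
    by (intro closed_idealD(5)[OF assms(1)]) (meson subsetD)
qed

section \<open>Continuous homomorphisms of completed free algebras\<close>

text \<open>The last clause is continuity, in the form that the h-adic order of a difference never
  drops; the clause on \<open>emb\<close>, with multiplicativity, gives linearity over the power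
  series ring.\<close>

definition cont_hom :: "('x free_alg fps \<Rightarrow> 'y free_alg fps) \<Rightarrow> bool" where
  "cont_hom \<Phi> \<longleftrightarrow> (\<forall>x y. \<Phi> (x + y) = \<Phi> x + \<Phi> y) \<and> (\<forall>x y. \<Phi> (x * y) = \<Phi> x * \<Phi> y) \<and>
     (\<forall>f. \<Phi> (emb f) = emb f) \<and>
     (\<forall>x y N. (\<forall>n\<le>N. fps_nth x n = fps_nth y n) \<longrightarrow> (\<forall>n\<le>N. fps_nth (\<Phi> x) n = fps_nth (\<Phi> y) n))"

lemma cont_homD:
  assumes "cont_hom \<Phi>"
  shows cont_hom_add: "\<Phi> (x + y) = \<Phi> x + \<Phi> y"
    and cont_hom_mult: "\<Phi> (x * y) = \<Phi> x * \<Phi> y"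
    and cont_hom_emb: "\<Phi> (emb f) = emb f"
    and cont_hom_cont: "(\<And>n. n \<le> N \<Longrightarrow> fps_nth x n = fps_nth y n) \<Longrightarrow> n \<le> N \<Longrightarrow>
       fps_nth (\<Phi> x) n = fps_nth (\<Phi> y) n"
  using assms unfolding cont_hom_def by blast+

lemma cont_hom_0: "cont_hom \<Phi> \<Longrightarrow> \<Phi> 0 = 0" and cont_hom_1: "cont_hom \<Phi> \<Longrightarrow> \<Phi> 1 = 1"
  using cont_hom_emb[of \<Phi> 0] cont_hom_emb[of \<Phi> 1] by simp_all

lemma cont_hom_minus: "cont_hom \<Phi> \<Longrightarrow> \<Phi> (- x) = - \<Phi> x"
  using cont_hom_add[of \<Phi> x "- x"] cont_hom_0[of \<Phi>] by (simp add: eq_neg_iff_add_eq_0 add.commute)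

lemma cont_hom_diff: "cont_hom \<Phi> \<Longrightarrow> \<Phi> (x - y) = \<Phi> x - \<Phi> y"
  using cont_hom_add[of \<Phi> x "- y"] cont_hom_minus[of \<Phi> y] by simp

lemma cont_hom_sum: "cont_hom \<Phi> \<Longrightarrow> \<Phi> (sum f A) = (\<Sum>i\<in>A. \<Phi> (f i))"
  by (induction A rule: infinite_finite_induct) (simp_all add: cont_hom_0 cont_hom_add)

lemma cont_hom_power: "cont_hom \<Phi> \<Longrightarrow> \<Phi> (x ^ n) = \<Phi> x ^ n"
  by (induction n) (simp_all add: cont_hom_1 cont_hom_mult)

lemma cont_hom_id: "cont_hom (\<lambda>x. x)"
  by (simp add: cont_hom_def)

lemma cont_hom_comp:
  fixes \<Phi> :: "'x free_alg fps \<Rightarrow> 'y free_alg fps"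
  assumes "cont_hom \<Phi>" "cont_hom \<Psi>"
  shows "cont_hom (\<lambda>x. \<Psi> (\<Phi> x))"
  unfolding cont_hom_def
proof (intro conjI allI impI)
  fix x y :: "'x free_alg fps" and N n
  assume "\<forall>n\<le>N. fps_nth x n = fps_nth y n" and n: "n \<le> N"
  then have "fps_nth (\<Phi> x) m = fps_nth (\<Phi> y) m" if "m \<le> N" for m
    using that by (intro cont_hom_cont[OF assms(1), of N]) auto
  then show "fps_nth (\<Psi> (\<Phi> x)) n = fps_nth (\<Psi> (\<Phi> y)) n"
    using n by (rule cont_hom_cont[OF assms(2)])
qed (simp_all add: cont_homD assms)

lemma closed_ideal_vimage:
  fixes \<Phi> :: "'x free_alg fps \<Rightarrow> 'y free_alg fps"
  assumes "cont_hom \<Phi>" "closed_ideal J"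
  shows "closed_ideal (\<Phi> -` J)"
  unfolding closed_ideal_def
proof (intro conjI allI impI)
  fix x :: "'x free_alg fps" assume x: "\<forall>N. \<exists>y\<in>\<Phi> -` J. \<forall>n\<le>N. fps_nth x n = fps_nth y n"
  have "\<Phi> x \<in> J"
  proof (rule closed_idealD(5)[OF assms(2)])
    fix N
    obtain y where "y \<in> \<Phi> -` J" "\<forall>n\<le>N. fps_nth x n = fps_nth y n" using x by blast
    then show "\<exists>y\<in>J. \<forall>n\<le>N. fps_nth (\<Phi> x) n = fps_nth y n"
      by (intro bexI[of _ "\<Phi> y"] allI impI cont_hom_cont[OF assms(1), of N]) auto
  qed
  then show "x \<in> \<Phi> -` J" by simp
qed (auto simp: cont_hom_0 cont_hom_add cont_hom_mult closed_idealD assms)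

text \<open>The preimage of a closed ideal is a closed ideal, so it contains the whole relation
  ideal as soon as it contains the relations.\<close>

lemma rel_ideal_image:
  assumes "cont_hom \<Phi>" "closed_ideal J" "\<And>x. x \<in> R \<Longrightarrow> \<Phi> x \<in> J" "x \<in> rel_ideal R"
  shows "\<Phi> x \<in> J"
  using rel_ideal_least[OF closed_ideal_vimage[OF assms(1,2)], of R] assms(3,4) by blast

section \<open>Reduction of power series to monomials\<close>

definition trunc :: "nat \<Rightarrow> 'a::ring_1 fps \<Rightarrow> 'a fps" where
  "trunc N x = (\<Sum>n\<le>N. fps_const (fps_nth x n) * fps_X ^ n)"

lemma fps_nth_trunc: "fps_nth (trunc N x) k = (if k \<le> N then fps_nth x k else 0)"
proof -
  have "fps_nth (trunc N x) k = (\<Sum>n\<le>N. if n = k then fps_nth x n else 0)"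
    unfolding trunc_def fps_sum_nth
    by (intro sum.cong) (auto simp: fps_X_power_mult_right_nth fps_const_def)
  then show ?thesis by simp
qed

text \<open>The coefficient of index \<open>N\<close> in the image depends only on the truncation at
  order \<open>N\<close>, a finite sum of monomials in h, to which additivity applies.\<close>

lemma trunc_ext:
  assumes "\<And>x y. \<Phi> (x + y) = \<Phi> x + (\<Phi> y :: 'b::ring_1 fps)" "\<Phi> 0 = 0"
    and "\<And>x y N. (\<And>n. n \<le> N \<Longrightarrow> fps_nth x n = fps_nth y n) \<Longrightarrow> fps_nth (\<Phi> x) N = fps_nth (\<Phi> y) N"
    and "\<And>x y. \<Psi> (x + y) = \<Psi> x + \<Psi> y" "\<Psi> 0 = 0"
    and "\<And>x y N. (\<And>n. n \<le> N \<Longrightarrow> fps_nth x n = fps_nth y n) \<Longrightarrow> fps_nth (\<Psi> x) N = fps_nth (\<Psi> y) N"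
    and "\<And>p n. \<Phi> (fps_const p * fps_X ^ n) = \<Psi> (fps_const p * fps_X ^ n)"
  shows "\<Phi> x = \<Psi> (x :: 'a::ring_1 fps)"
proof (rule fps_ext)
  fix N
  have sum: "\<Phi> (sum f A) = (\<Sum>i\<in>A. \<Phi> (f i))" "\<Psi> (sum f A) = (\<Sum>i\<in>A. \<Psi> (f i))" for f and A :: "nat set"
    by (induction A rule: infinite_finite_induct) (simp_all add: assms)
  have "fps_nth (\<Phi> x) N = fps_nth (\<Phi> (trunc N x)) N"
    by (rule assms(3)) (simp add: fps_nth_trunc)
  also have "\<Phi> (trunc N x) = \<Psi> (trunc N x)"
    by (simp add: trunc_def sum assms)
  also have "fps_nth \<dots> N = fps_nth (\<Psi> x) N"
    by (rule assms(6)) (simp add: fps_nth_trunc)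
  finally show "fps_nth (\<Phi> x) N = fps_nth (\<Psi> x) N" .
qed

lemma Word_Cons: "Word (x # xs) = Word [x] + Word xs"
  by (simp add: plus_word_def)

text \<open>Uniqueness in the universal property: agreement spreads from generators to words, to
  multiples of words, to polynomials, and finally to series by \<open>trunc_ext\<close>.\<close>

lemma cont_hom_ext:
  assumes "cont_hom \<Phi>" "cont_hom \<Psi>" "\<And>x. \<Phi> (gen_fps x) = \<Psi> (gen_fps x)"
  shows "\<Phi> y = \<Psi> y"
proof -
  have word: "\<Phi> (fps_const (Poly_Mapping.single (Word xs) 1)) = \<Psi> (fps_const (Poly_Mapping.single (Word xs) 1))" for xs
  proof (induction xs)
    case Nil
    have "fps_const (Poly_Mapping.single (Word []) 1) = (1 :: 'a free_alg fps)"
      by (simp flip: zero_word_def)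
    then show ?case by (simp add: cont_hom_1 assms)
  next
    case (Cons x xs)
    have "fps_const (Poly_Mapping.single (Word (x # xs)) 1) =
        gen_fps x * fps_const (Poly_Mapping.single (Word xs) (1 :: complex))"
      by (simp add: gen_fps_def gen_def mult_single Word_Cons[of x xs])
    then show ?case by (simp add: cont_hom_mult assms Cons.IH)
  qed
  have single: "\<Phi> (fps_const (Poly_Mapping.single w c)) = \<Psi> (fps_const (Poly_Mapping.single w c))" for w c
  proof -
    obtain xs where "w = Word xs" by (cases w)
    then have "fps_const (Poly_Mapping.single w c) =
        emb (fps_const c) * fps_const (Poly_Mapping.single (Word xs) 1)"
      by (simp add: emb_fps_const cst_def mult_single)
    then show ?thesis by (simp add: cont_hom_mult cont_hom_emb assms word)
  qed
  have const: "\<Phi> (fps_const p) = \<Psi> (fps_const p)" for p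
    by (induction p rule: poly_mapping_single_induct)
      (simp_all add: single cont_hom_0 assms cont_hom_add flip: fps_const_add)
  have X: "\<Phi> (fps_X ^ n) = fps_X ^ n" "\<Psi> (fps_X ^ n) = fps_X ^ n" for n
    using cont_hom_emb[of _ "fps_X ^ n"] assms by (simp_all add: emb_power emb_fps_X)
  show ?thesis
  proof (rule trunc_ext[of \<Phi> \<Psi>])
    show "fps_nth (\<Phi> x) N = fps_nth (\<Phi> y) N" "fps_nth (\<Psi> x) N = fps_nth (\<Psi> y) N"
      if "\<And>n. n \<le> N \<Longrightarrow> fps_nth x n = fps_nth y n" for x y N
      using that by (auto intro: cont_hom_cont[OF assms(1), of N] cont_hom_cont[OF assms(2), of N])
  qed (simp_all add: cont_hom_add cont_hom_0 cont_hom_mult assms const X)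
qed

text \<open>Since h is fixed, fixing every coefficient fixes every truncation. The intended series
  are exponentials, whose coefficients are polynomials in the \<open>gH j\<close>.\<close>

lemma cont_hom_fixes:
  assumes "cont_hom \<Phi>" "\<And>n. \<Phi> (fps_const (fps_nth x n)) = fps_const (fps_nth x n)"
  shows "\<Phi> x = x"
proof (rule fps_ext)
  fix N
  have X: "\<Phi> (fps_X ^ n) = fps_X ^ n" for n
    using cont_hom_emb[of _ "fps_X ^ n"] assms by (simp add: emb_power emb_fps_X)
  have "fps_nth (\<Phi> x) N = fps_nth (\<Phi> (trunc N x)) N"
    by (rule cont_hom_cont[OF assms(1), of N]) (simp_all add: fps_nth_trunc)
  also have "\<Phi> (trunc N x) = trunc N x"
    by (simp add: trunc_def cont_hom_sum cont_hom_mult assms X)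
  finally show "fps_nth (\<Phi> x) N = fps_nth x N" by (simp add: fps_nth_trunc)
qed

section \<open>Substitution homomorphisms\<close>

definition word_img :: "('x \<Rightarrow> 'y free_alg fps) \<Rightarrow> 'x word \<Rightarrow> 'y free_alg fps" where
  "word_img \<theta> w = prod_list (map \<theta> (letters w))"

definition poly_img :: "('x \<Rightarrow> 'y free_alg fps) \<Rightarrow> 'x free_alg \<Rightarrow> 'y free_alg fps" where
  "poly_img \<theta> p =
     (\<Sum>w\<in>Poly_Mapping.keys p. emb (fps_const (Poly_Mapping.lookup p w)) * word_img \<theta> w)"

text \<open>This is the sum over n of the image of the n-th coefficient times h^n, with equal powers
  of h collected. Only the indices n \<le> k reach the coefficient of index k, so the values of
  \<theta> may be arbitrary power series.\<close>

definition subst_hom :: "('x \<Rightarrow> 'y free_alg fps) \<Rightarrow> 'x free_alg fps \<Rightarrow> 'y free_alg fps" where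
  "subst_hom \<theta> x = Abs_fps (\<lambda>k. \<Sum>n\<le>k. fps_nth (poly_img \<theta> (fps_nth x n)) (k - n))"

lemma poly_img_superset:
  assumes "finite S" "Poly_Mapping.keys p \<subseteq> S"
  shows "poly_img \<theta> p = (\<Sum>w\<in>S. emb (fps_const (Poly_Mapping.lookup p w)) * word_img \<theta> w)"
  unfolding poly_img_def
  by (rule sum.mono_neutral_left) (use assms in \<open>auto simp: in_keys_iff\<close>)

lemma poly_img_add: "poly_img \<theta> (p + q) = poly_img \<theta> p + poly_img \<theta> q"
proof -
  let ?S = "Poly_Mapping.keys p \<union> Poly_Mapping.keys q"
  have "Poly_Mapping.keys (p + q) \<subseteq> ?S" by (rule Poly_Mapping.keys_add)
  then show ?thesis
    by (simp add: poly_img_superset[of ?S] lookup_add emb_add distrib_right sum.distrib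
        flip: fps_const_add)
qed

lemma poly_img_0 [simp]: "poly_img \<theta> 0 = 0"
  by (simp add: poly_img_def)

lemma poly_img_single: "poly_img \<theta> (Poly_Mapping.single w c) = emb (fps_const c) * word_img \<theta> w"
  by (simp add: poly_img_def)

lemma word_img_add: "word_img \<theta> (u + v) = word_img \<theta> u * word_img \<theta> v"
  by (simp add: word_img_def plus_word_def)

lemma emb_mult_mult: "emb f * x * (emb g * y) = emb (f * g) * (x * y)"
  by (metis emb_left_commute emb_mult mult.assoc)

lemma poly_img_mult: "poly_img \<theta> (p * q) = poly_img \<theta> p * poly_img \<theta> q"
proof (induction p rule: poly_mapping_single_induct)
  case (single u c)
  show ?case
  proof (induction q rule: poly_mapping_single_induct)
    case (single v e)
    show ?case
      by (simp add: mult_single poly_img_single word_img_add emb_mult_mult flip: fps_const_mult)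
  qed (simp_all add: distrib_left poly_img_add)
qed (simp_all add: distrib_right poly_img_add)

lemma subst_hom_add: "subst_hom \<theta> (x + y) = subst_hom \<theta> x + subst_hom \<theta> y"
  by (simp add: fps_eq_iff subst_hom_def poly_img_add sum.distrib)

lemma subst_hom_0: "subst_hom \<theta> 0 = 0"
  by (simp add: fps_eq_iff subst_hom_def)

lemma subst_hom_cont:
  "(\<And>n. n \<le> N \<Longrightarrow> fps_nth x n = fps_nth y n) \<Longrightarrow> n \<le> N \<Longrightarrow>
    fps_nth (subst_hom \<theta> x) n = fps_nth (subst_hom \<theta> y) n"
  by (simp add: subst_hom_def)

lemma subst_hom_monom: "subst_hom \<theta> (fps_const p * fps_X ^ n) = poly_img \<theta> p * fps_X ^ n"
proof (rule fps_ext)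
  fix k
  have "fps_nth (subst_hom \<theta> (fps_const p * fps_X ^ n)) k =
      (\<Sum>m\<le>k. if m = n then fps_nth (poly_img \<theta> p) (k - m) else 0)"
    unfolding subst_hom_def fps_nth_Abs_fps
    by (intro sum.cong) (auto simp: fps_X_power_mult_right_nth fps_const_def)
  then show "fps_nth (subst_hom \<theta> (fps_const p * fps_X ^ n)) k = fps_nth (poly_img \<theta> p * fps_X ^ n) k"
    by (simp add: fps_X_power_mult_right_nth)
qed

lemma mult_cont:
  fixes x y :: "'a::ring_1 fps"
  assumes "\<And>n. n \<le> N \<Longrightarrow> fps_nth x n = fps_nth x' n" "\<And>n. n \<le> N \<Longrightarrow> fps_nth y n = fps_nth y' n"
    and "n \<le> N"
  shows "fps_nth (x * y) n = fps_nth (x' * y') n"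
  unfolding fps_mult_nth by (rule sum.cong) (use assms in auto)

text \<open>Both sides are additive and continuous in each argument, so \<open>trunc_ext\<close> is
  used twice, first for the left and then for the right factor. On monomials only centrality of h
  and multiplicativity on polynomials remain.\<close>

lemma subst_hom_mult:
  fixes \<theta> :: "'x \<Rightarrow> 'y free_alg fps"
  shows "subst_hom \<theta> (x * y) = subst_hom \<theta> x * subst_hom \<theta> y"
proof (rule trunc_ext[of "\<lambda>x. subst_hom \<theta> (x * y)" "\<lambda>x. subst_hom \<theta> x * subst_hom \<theta> y"])
  fix p n
  show "subst_hom \<theta> (fps_const p * fps_X ^ n * y) = subst_hom \<theta> (fps_const p * fps_X ^ n) * subst_hom \<theta> y"
  proof (rule trunc_ext[of "\<lambda>y. subst_hom \<theta> (fps_const p * fps_X ^ n * y)"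
        "\<lambda>y. subst_hom \<theta> (fps_const p * fps_X ^ n) * subst_hom \<theta> y"])
    fix q m
    have X: "fps_X ^ n * (z * u) = z * (fps_X ^ n * u)" for z u :: "'c::ring_1 fps"
      by (metis fps_mult_fps_X_power_commute mult.assoc)
    have "fps_const p * fps_X ^ n * (fps_const q * fps_X ^ m) = fps_const (p * q) * fps_X ^ (n + m)"
      by (simp add: mult.assoc X power_add flip: fps_const_mult)
    then show "subst_hom \<theta> (fps_const p * fps_X ^ n * (fps_const q * fps_X ^ m)) =
        subst_hom \<theta> (fps_const p * fps_X ^ n) * subst_hom \<theta> (fps_const q * fps_X ^ m)"
      by (simp only: subst_hom_monom) (simp add: poly_img_mult mult.assoc X power_add)
  next
    fix y y' :: "'x free_alg fps" and N assume *: "\<And>n. n \<le> N \<Longrightarrow> fps_nth y n = fps_nth y' n"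
    show "fps_nth (subst_hom \<theta> (fps_const p * fps_X ^ n * y)) N =
        fps_nth (subst_hom \<theta> (fps_const p * fps_X ^ n * y')) N"
      by (rule subst_hom_cont[of N], rule mult_cont[of N]) (use * in auto)
    show "fps_nth (subst_hom \<theta> (fps_const p * fps_X ^ n) * subst_hom \<theta> y) N =
        fps_nth (subst_hom \<theta> (fps_const p * fps_X ^ n) * subst_hom \<theta> y') N"
      by (rule mult_cont[of N], simp, rule subst_hom_cont[of N]) (use * in auto)
  qed (simp_all add: distrib_left subst_hom_add subst_hom_0)
next
  fix x x' :: "'x free_alg fps" and N assume *: "\<And>n. n \<le> N \<Longrightarrow> fps_nth x n = fps_nth x' n"
  show "fps_nth (subst_hom \<theta> (x * y)) N = fps_nth (subst_hom \<theta> (x' * y)) N"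
    by (rule subst_hom_cont[of N], rule mult_cont[of N]) (use * in auto)
  show "fps_nth (subst_hom \<theta> x * subst_hom \<theta> y) N = fps_nth (subst_hom \<theta> x' * subst_hom \<theta> y) N"
    by (rule mult_cont[of N], rule subst_hom_cont[of N]) (use * in auto)
qed (simp_all add: distrib_right subst_hom_add subst_hom_0)

lemma cont_hom_subst_hom: "cont_hom (subst_hom \<theta>)"
proof -
  have "subst_hom \<theta> (emb f) = emb f" for f
  proof (rule fps_ext)
    fix k
    have "fps_nth (subst_hom \<theta> (emb f)) k = (\<Sum>n\<le>k. if n = k then cst (fps_nth f n) else 0)"
      unfolding subst_hom_def fps_nth_Abs_fps fps_nth_emb cst_def poly_img_single
      by (intro sum.cong) (auto simp: word_img_def zero_word_def cst_def fps_const_def)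
    then show "fps_nth (subst_hom \<theta> (emb f)) k = fps_nth (emb f) k" by simp
  qed
  then show ?thesis
    unfolding cont_hom_def by (auto simp: subst_hom_add subst_hom_mult intro: subst_hom_cont)
qed

lemma subst_hom_gen: "subst_hom \<theta> (gen_fps x) = \<theta> x"
  using subst_hom_monom[of \<theta> "gen x" 0]
  by (simp add: gen_fps_def gen_def poly_img_single word_img_def)

section \<open>Isomorphisms of presented algebras\<close>

lemma ideal_rel_ideal: "ideal (rel_ideal R) free_ring"
  by (simp add: ideal_free_ring_iff closed_idealD[OF closed_ideal_rel_ideal])

lemma cls_eq: "cls R x = (\<lambda>j. j + x) ` rel_ideal R"
  by (auto simp: cls_def a_r_coset_def r_coset_def)

lemma cls_eq_iff: "cls R x = cls R y \<longleftrightarrow> x - y \<in> rel_ideal R"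
proof
  assume "cls R x = cls R y"
  moreover have "x \<in> cls R x"
    using closed_idealD(1)[OF closed_ideal_rel_ideal] by (force simp: cls_eq)
  ultimately show "x - y \<in> rel_ideal R" by (auto simp: cls_eq)
next
  assume xy: "x - y \<in> rel_ideal R"
  have "cls R u \<subseteq> cls R v" if "u - v \<in> rel_ideal R" for u v
  proof
    fix z assume "z \<in> cls R u"
    then have "z - u \<in> rel_ideal R" by (auto simp: cls_eq)
    from closed_idealD(2)[OF closed_ideal_rel_ideal this that]
    show "z \<in> cls R v" by (auto simp: cls_eq intro!: image_eqI[of _ _ "z - v"])
  qed
  from this[OF xy] this[of y x] closed_ideal_minus[OF closed_ideal_rel_ideal xy]
  show "cls R x = cls R y" by auto
qed

lemma presented_alg_simps:
  "carrier (presented_alg R) = range (cls R)"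
  "\<one>\<^bsub>presented_alg R\<^esub> = cls R 1"
  "cls R x \<otimes>\<^bsub>presented_alg R\<^esub> cls R y = cls R (x * y)"
  "cls R x \<oplus>\<^bsub>presented_alg R\<^esub> cls R y = cls R (x + y)"
  "f \<odot>\<^bsub>presented_alg R\<^esub> cls R x = cls R (f *h x)"
proof -
  interpret ideal "rel_ideal R" free_ring by (rule ideal_rel_ideal)
  show "carrier (presented_alg R) = range (cls R)"
    by (auto simp: presented_alg_def ring.defs FactRing_def A_RCOSETS_def RCOSETS_def
        a_r_coset_def cls_def)
  show "\<one>\<^bsub>presented_alg R\<^esub> = cls R 1"
    by (simp add: presented_alg_def ring.defs FactRing_def cls_def)
  show "cls R x \<otimes>\<^bsub>presented_alg R\<^esub> cls R y = cls R (x * y)"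
    using rcoset_mult_add[of x y] by (simp add: presented_alg_def ring.defs FactRing_def cls_def)
  show "cls R x \<oplus>\<^bsub>presented_alg R\<^esub> cls R y = cls R (x + y)"
    using a_rcos_sum[of x y] by (simp add: presented_alg_def ring.defs FactRing_def cls_def)
  \<comment> \<open>All representatives \<open>z\<close> of a class give the same class, so the
    union that defines the scalar product collapses.\<close>
  have "cls R (f *h z) = cls R (f *h x)" if "z \<in> cls R x" for z
    using that closed_idealD(3)[OF closed_ideal_rel_ideal]
    by (auto simp: cls_eq_iff cls_eq[of R x] scal_emb distrib_left)
  then have "(\<Union>z\<in>cls R x. cls R (f *h z)) = (\<Union>z\<in>cls R x. cls R (f *h x))"
    by (rule SUP_cong[OF refl])
  also have "cls R x \<noteq> {}"
    using closed_idealD(1)[OF closed_ideal_rel_ideal] by (auto simp: cls_eq)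
  then have "(\<Union>z\<in>cls R x. cls R (f *h x)) = cls R (f *h x)" by simp
  finally show "f \<odot>\<^bsub>presented_alg R\<^esub> cls R x = cls R (f *h x)"
    by (simp add: presented_alg_def ring.defs module.defs)
qed

text \<open>Checking the relations in both directions, together with the two inverse identities,
  makes \<Phi> map one relation ideal onto the other and not merely into it.\<close>

lemma alg_iso_of_inverse_homs:
  assumes hom: "cont_hom \<Phi>" "cont_hom \<Psi>" and inv: "\<And>x. \<Psi> (\<Phi> x) = x" "\<And>y. \<Phi> (\<Psi> y) = y"
    and rels: "\<And>x. x \<in> R \<Longrightarrow> \<Phi> x \<in> rel_ideal S" "\<And>y. y \<in> S \<Longrightarrow> \<Psi> y \<in> rel_ideal R"
  shows "\<exists>\<psi>\<in>alg_iso (presented_alg R) (presented_alg S). \<forall>x. \<psi> (cls R x) = cls S (\<Phi> x)"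
proof -
  have J1: "\<Phi> x \<in> rel_ideal S" if "x \<in> rel_ideal R" for x
    using rel_ideal_image[OF hom(1) closed_ideal_rel_ideal _ that] rels(1) by blast
  have J2: "\<Psi> y \<in> rel_ideal R" if "y \<in> rel_ideal S" for y
    using rel_ideal_image[OF hom(2) closed_ideal_rel_ideal _ that] rels(2) by blast
  have J_eq: "\<Phi> ` rel_ideal R = rel_ideal S"
  proof
    show "rel_ideal S \<subseteq> \<Phi> ` rel_ideal R"
    proof
      fix y assume "y \<in> rel_ideal S"
      then show "y \<in> \<Phi> ` rel_ideal R" 
        by (intro image_eqI[of _ _ "\<Psi> y"]) (simp_all add: inv J2)
    qed
  qed (use J1 in blast)
  have img: "\<Phi> ` cls R x = cls S (\<Phi> x)" for x
    unfolding cls_eq J_eq[symmetric] by (simp add: image_image cont_hom_add[OF hom(1)])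
  have "inj \<Phi>" using inv(1) by (metis injI)
  \<comment> \<open>Direct images of cosets give the isomorphism without a choice of
    representatives.\<close>
  have "(`) \<Phi> \<in> alg_iso (presented_alg R) (presented_alg S)"
    unfolding alg_iso_def
  proof (intro CollectI conjI allI ballI ring_iso_memI)
    show "bij_betw ((`) \<Phi>) (carrier (presented_alg R)) (carrier (presented_alg S))"
      unfolding bij_betw_def
    proof
      show "inj_on ((`) \<Phi>) (carrier (presented_alg R))"
        using \<open>inj \<Phi>\<close> by (auto simp: inj_on_def inj_image_eq_iff)
      show "(`) \<Phi> ` carrier (presented_alg R) = carrier (presented_alg S)"
        unfolding presented_alg_simps by (auto simp: img image_image) (metis inv(2) rangeI)
    qed
  qed (auto simp: presented_alg_simps img cont_hom_add cont_hom_mult cont_hom_1 cont_hom_emb scal_emb hom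
      del: equalityI)
  with img show ?thesis by blast
qed

section \<open>Exponentials\<close>

lemma cst_power: "cst (w ^ n) = cst w ^ n"
  by (induction n) (simp_all add: cst_mult)

text \<open>This is the binomial theorem for divided powers, by induction on the degree: multiplying
  by \<open>u + v\<close> raises the degree, and the result is divided by
  \<open>Suc n\<close>.\<close>

lemma hexp_add:
  assumes comm: "u * v = v * u"
  shows "hexp (u + v) = hexp u * hexp v"
proof (rule fps_ext)
  fix n
  define S where "S x k = cst (1 / fact k) * x ^ k" for x :: "'a free_alg" and k
  have S_Suc: "x * S x k = cst (of_nat (Suc k)) * S x (Suc k)" for x k
  proof -
    have "cst (of_nat (Suc k)) * S x (Suc k) = cst (of_nat (Suc k) * (1 / fact (Suc k))) * x ^ Suc k"
      by (simp only: S_def cst_mult mult.assoc)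
    also have "of_nat (Suc k) * (1 / fact (Suc k)) = (1 / fact k :: complex)"
      by (simp del: of_nat_Suc)
    also have "cst (1 / fact k) * x ^ Suc k = x * S x k"
      unfolding S_def power_Suc by (metis cst_commute mult.assoc)
    finally show ?thesis by simp
  qed
  have v_S: "v * S u k = S u k * v" for k
    unfolding S_def using power_commuting_commutes[OF comm, of k] by (metis cst_commute mult.assoc)
  have "S (u + v) n = (\<Sum>i\<le>n. S u i * S v (n - i))"
  proof (induction n)
    case 0
    show ?case by (simp add: S_def)
  next
    case (Suc n)
    have "cst (of_nat (Suc n)) * S (u + v) (Suc n) = (u + v) * (\<Sum>i\<le>n. S u i * S v (n - i))"
      by (simp only: Suc S_Suc[symmetric])
    also have "\<dots> = (\<Sum>i\<le>n. u * S u i * S v (n - i)) + (\<Sum>i\<le>n. S u i * (v * S v (n - i)))"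
      by (simp add: distrib_right sum_distrib_left mult.assoc v_S[symmetric] flip: sum.distrib)
        (simp add: v_S flip: mult.assoc)
    also have "(\<Sum>i\<le>n. u * S u i * S v (n - i)) =
        (\<Sum>i\<le>n. cst (of_nat (Suc i)) * (S u (Suc i) * S v (n - i)))"
      by (simp only: S_Suc mult.assoc)
    \<comment> \<open>The shift adds the term \<open>i = 0\<close>, whose scalar factor vanishes; so
      does that of the term \<open>i = Suc n\<close> added to the second sum below.\<close>
    also have "\<dots> = (\<Sum>i\<le>Suc n. cst (of_nat i) * (S u i * S v (Suc n - i)))"
      by (subst sum.atMost_Suc_shift) (simp del: of_nat_Suc)
    also have "(\<Sum>i\<le>n. S u i * (v * S v (n - i))) =
        (\<Sum>i\<le>n. cst (of_nat (Suc n - i)) * (S u i * S v (Suc n - i)))"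
    proof (rule sum.cong[OF refl])
      fix i assume "i \<in> {..n}"
      then have "v * S v (n - i) = cst (of_nat (Suc n - i)) * S v (Suc n - i)"
        by (simp only: S_Suc Suc_diff_le atMost_iff)
      then show "S u i * (v * S v (n - i)) = cst (of_nat (Suc n - i)) * (S u i * S v (Suc n - i))"
        by (metis cst_commute mult.assoc)
    qed
    also have "\<dots> = (\<Sum>i\<le>Suc n. cst (of_nat (Suc n - i)) * (S u i * S v (Suc n - i)))"
      by simp
    \<comment> \<open>The factors \<open>i\<close> and \<open>Suc n - i\<close> add up to
      \<open>Suc n\<close> in every term.\<close>
    also have "(\<Sum>i\<le>Suc n. cst (of_nat i) * (S u i * S v (Suc n - i))) + \<dots> =
        cst (of_nat (Suc n)) * (\<Sum>i\<le>Suc n. S u i * S v (Suc n - i))"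
      unfolding sum.distrib[symmetric] sum_distrib_left distrib_right[symmetric] cst_add[symmetric]
        of_nat_add[symmetric]
      by (intro sum.cong) auto
    finally have "cst (1 / of_nat (Suc n)) * (cst (of_nat (Suc n)) * S (u + v) (Suc n)) =
        cst (1 / of_nat (Suc n)) * (cst (of_nat (Suc n)) * (\<Sum>i\<le>Suc n. S u i * S v (Suc n - i)))"
      by (simp only:)
    moreover have "cst (1 / of_nat (Suc n)) * (cst (of_nat (Suc n)) * x) = x" for x :: "'a free_alg"
      by (simp add: mult.assoc[symmetric] cst_mult[symmetric] del: of_nat_Suc)
    ultimately show ?case by simp
  qed
  then show "fps_nth (hexp (u + v)) n = fps_nth (hexp u * hexp v) n"
    by (simp add: hexp_def S_def fps_mult_nth atLeast0AtMost)
qed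

lemma hexp_cst: "hexp (cst w) = emb (qpow w)"
  by (simp add: fps_eq_iff hexp_def qpow_def cst_power[symmetric] cst_mult[symmetric])

lemma hexp_0: "hexp 0 = 1"
  using hexp_cst[of 0] by (simp add: qpow_def)

lemma hexp_minus: "hexp u * hexp (- u) = 1"
  using hexp_add[of u "- u"] by (simp add: hexp_0)

lemma emb_qpow_add: "emb (qpow (s + t)) = emb (qpow s) * emb (qpow t)"
  by (simp add: qpow_def fps_exp_add_mult emb_mult)

lemma emb_qpow_0 [simp]: "emb (qpow 0) = 1"
  by (simp add: qpow_def)

section \<open>Products of exponentials of Cartan elements\<close>

definition lin :: "('i::finite \<Rightarrow> complex) \<Rightarrow> 'i generator free_alg" where
  "lin z = (\<Sum>j\<in>UNIV. cst (z j) * gen (Hgen j))"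

text \<open>A list is kept because the \<open>gH j\<close> do not commute in the free algebra, where
  the order of the exponentials therefore matters.\<close>

definition hprod :: "('i::finite \<Rightarrow> complex) list \<Rightarrow> 'i generator free_alg fps" where
  "hprod zs = prod_list (map (\<lambda>z. hexp (lin z)) zs)"

definition neg :: "('i \<Rightarrow> complex) \<Rightarrow> 'i \<Rightarrow> complex" where
  "neg z = (\<lambda>j. - z j)"

lemma neg_neg [simp]: "neg (neg z) = z"
  by (simp add: neg_def)

lemma cst_minus: "cst (- x) = - cst x"
  using cst_diff[of 0 x] by simp

lemma lin_neg: "lin (neg z) = - lin z"
  by (simp add: lin_def neg_def cst_minus sum_negf)

lemma hexp_lin_neg: "hexp (lin z) * hexp (lin (neg z)) = 1" "hexp (lin (neg z)) * hexp (lin z) = 1"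
  using hexp_minus[of "lin z"] hexp_minus[of "- lin z"] by (simp_all add: lin_neg)

lemma hprod_Nil [simp]: "hprod [] = 1"
  and hprod_Cons [simp]: "hprod (z # zs) = hexp (lin z) * hprod zs"
  and hprod_append: "hprod (zs @ ys) = hprod zs * hprod ys"
  by (simp_all add: hprod_def)

text \<open>An exact inverse, before any relation is imposed, is obtained by reversing the order of
  the factors. It makes the twist invertible on the free algebra.\<close>

lemma hprod_rev_neg: "hprod zs * hprod (rev (map neg zs)) = 1"
proof (induction zs)
  case (Cons z zs)
  have "hprod (z # zs) * hprod (rev (map neg (z # zs))) =
      hexp (lin z) * (hprod zs * hprod (rev (map neg zs))) * hexp (lin (neg z))"
    by (simp add: hprod_append mult.assoc)
  then show ?case by (simp add: Cons hexp_lin_neg)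
qed simp

lemma hprod_rev_neg': "hprod (rev (map neg zs)) * hprod zs = 1"
  using hprod_rev_neg[of "rev (map neg zs)"] by (simp add: rev_map comp_def)

lemma cont_hom_fps_const_lin:
  assumes "cont_hom \<Phi>" "\<And>j. \<Phi> (gH j) = gH j"
  shows "\<Phi> (fps_const (lin z)) = fps_const (lin z)"
proof -
  have "fps_const (lin z) = (\<Sum>j\<in>UNIV. emb (fps_const (z j)) * gH j)"
    by (simp add: lin_def gen_fps_def emb_fps_const fps_eq_iff fps_sum_nth)
  then show ?thesis by (simp add: cont_hom_sum cont_hom_mult cont_hom_emb assms)
qed

lemma cont_hom_hexp:
  assumes "cont_hom \<Phi>" "\<Phi> (fps_const u) = fps_const u"
  shows "\<Phi> (fps_const (fps_nth (hexp u) n)) = fps_const (fps_nth (hexp u) n)"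
proof -
  have "fps_const (fps_nth (hexp u) n) = emb (fps_const (1 / fact n)) * fps_const u ^ n"
    by (simp add: hexp_def emb_fps_const fps_const_power)
  then show ?thesis
    by (simp only: cont_hom_mult[OF assms(1)] cont_hom_emb[OF assms(1)] cont_hom_power[OF assms(1)]
        assms(2))
qed

text \<open>The coefficients of each exponential are polynomials in the \<open>gH j\<close>. Hence a
  second twist leaves the Cartan factors of the first unchanged.\<close>

lemma cont_hom_hprod:
  assumes "cont_hom \<Phi>" "\<And>j. \<Phi> (gH j) = gH j"
  shows "\<Phi> (hprod zs) = hprod zs"
proof -
  have "\<Phi> (hexp (lin z)) = hexp (lin z)" for z
    by (rule cont_hom_fixes[OF assms(1)], rule cont_hom_hexp[OF assms(1)],
        rule cont_hom_fps_const_lin[OF assms])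
  then show ?thesis
    by (induction zs) (simp_all add: cont_hom_1 cont_hom_mult assms(1))
qed

lemma lin_single: "cst c * gen (Hgen i) = lin (\<lambda>j. if j = i then c else 0)"
  by (simp add: lin_def if_distrib[of cst] if_distrib[of "\<lambda>x. x * _"] cong: if_cong)

lemma cont_hom_Kquot:
  fixes \<Phi> :: "'i::finite generator free_alg fps \<Rightarrow> 'i generator free_alg fps"
  assumes "cont_hom \<Phi>" "\<And>j. \<Phi> (gH j) = gH j"
  shows "\<Phi> (Kquot d i) = Kquot d i"
proof -
  \<comment> \<open>Shifting only renumbers the coefficients, each of which is a polynomial in
    \<open>gen (Hgen i)\<close>.\<close>
  have "\<Phi> (fps_shift 1 (Kpos d i - Kneg d i)) = fps_shift 1 (Kpos d i - Kneg d i)"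
    by (rule cont_hom_fixes[OF assms(1)])
      (simp add: Kpos_def Kneg_def lin_single cont_hom_diff[OF assms(1)]
        cont_hom_hexp[OF assms(1) cont_hom_fps_const_lin[OF assms]] flip: fps_const_sub)
  then show ?thesis
    by (simp add: Kquot_def scal_emb cont_hom_mult cont_hom_emb assms)
qed

section \<open>Commutation up to powers of q modulo a closed ideal\<close>

locale closed_congruence =
  fixes J :: "'x free_alg fps set"
  assumes closed: "closed_ideal J"
begin

definition eqv :: "'x free_alg fps \<Rightarrow> 'x free_alg fps \<Rightarrow> bool" (infix \<open>\<asymp>\<close> 50) where
  "x \<asymp> y \<longleftrightarrow> x - y \<in> J"

lemma eqv_refl [simp]: "x \<asymp> x"
  by (simp add: eqv_def closed_idealD(1)[OF closed])

lemma eqv_sym: "x \<asymp> y \<Longrightarrow> y \<asymp> x"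
  unfolding eqv_def using closed_ideal_minus[OF closed, of "x - y"] by simp

lemma eqv_trans [trans]: "x \<asymp> y \<Longrightarrow> y \<asymp> z \<Longrightarrow> x \<asymp> z"
  unfolding eqv_def using closed_idealD(2)[OF closed, of "x - y" "y - z"] by simp

lemma eqv_add: "x \<asymp> y \<Longrightarrow> u \<asymp> v \<Longrightarrow> x + u \<asymp> y + v"
  unfolding eqv_def using closed_idealD(2)[OF closed, of "x - y" "u - v"] by (simp add: algebra_simps)

lemma eqv_diff: "x \<asymp> y \<Longrightarrow> u \<asymp> v \<Longrightarrow> x - u \<asymp> y - v"
  unfolding eqv_def using closed_ideal_diff[OF closed, of "x - y" "u - v"] by (simp add: algebra_simps)

lemma eqv_mult: "x \<asymp> y \<Longrightarrow> u \<asymp> v \<Longrightarrow> x * u \<asymp> y * v"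
  unfolding eqv_def
  using closed_idealD(2)[OF closed closed_idealD(4)[OF closed, of "x - y" u]
      closed_idealD(3)[OF closed, of "u - v" y]]
  by (simp add: algebra_simps)

lemma eqv_multL: "u \<asymp> v \<Longrightarrow> x * u \<asymp> x * v"
  and eqv_multR: "u \<asymp> v \<Longrightarrow> u * x \<asymp> v * x"
  by (simp_all add: eqv_mult)

lemma eqv_sum: "(\<And>i. i \<in> A \<Longrightarrow> f i \<asymp> g i) \<Longrightarrow> sum f A \<asymp> sum g A"
  by (induction A rule: infinite_finite_induct) (simp_all add: eqv_add)

lemma eqv_mem: "x \<asymp> y \<Longrightarrow> y \<in> J \<Longrightarrow> x \<in> J"
  unfolding eqv_def using closed_idealD(2)[OF closed, of "x - y" y] by simp

text \<open>Summing the coefficientwise congruences proves the claim for truncations, and closedness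
  of \<open>J\<close> allows the passage to the limit.\<close>

lemma eqv_fps:
  assumes "\<And>n. fps_const (fps_nth f n) * x \<asymp> x * fps_const (fps_nth g n)"
  shows "f * x \<asymp> x * g"
  unfolding eqv_def
proof (rule closed_idealD(5)[OF closed])
  fix N
  have X: "x * fps_X ^ n = fps_X ^ n * x" for n
    by (simp add: fps_mult_fps_X_power_commute)
  have "trunc N f * x = (\<Sum>n\<le>N. fps_const (fps_nth f n) * x * fps_X ^ n)"
    by (simp add: trunc_def sum_distrib_right mult.assoc X)
  also have "\<dots> \<asymp> (\<Sum>n\<le>N. x * fps_const (fps_nth g n) * fps_X ^ n)"
    by (intro eqv_sum eqv_multR assms)
  also have "\<dots> = x * trunc N g"
    by (simp add: trunc_def sum_distrib_left mult.assoc)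
  finally have "trunc N f * x - x * trunc N g \<in> J"
    by (simp add: eqv_def)
  moreover have "fps_nth (f * x) n = fps_nth (trunc N f * x) n" "fps_nth (x * g) n = fps_nth (x * trunc N g) n"
    if "n \<le> N" for n
    using that by (auto intro!: mult_cont[of N] simp: fps_nth_trunc)
  ultimately show "\<exists>y\<in>J. \<forall>n\<le>N. fps_nth (f * x - x * g) n = fps_nth y n"
    by (intro bexI[of _ "trunc N f * x - x * trunc N g"]) auto
qed

section \<open>q-commutation and normal forms\<close>

definition qcomm :: "complex \<Rightarrow> 'x free_alg fps \<Rightarrow> 'x free_alg fps \<Rightarrow> bool" where
  "qcomm t x y \<longleftrightarrow> x * y \<asymp> emb (qpow t) * (y * x)"

lemma qcommD: "qcomm t x y \<Longrightarrow> x * y \<asymp> emb (qpow t) * (y * x)"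
  by (simp add: qcomm_def)

lemma qcomm_multL:
  assumes "qcomm s x z" "qcomm t y z"
  shows "qcomm (s + t) (x * y) z"
proof -
  have "x * y * z \<asymp> x * (emb (qpow t) * (z * y))"
    unfolding mult.assoc by (intro eqv_multL qcommD assms)
  also have "\<dots> = emb (qpow t) * (x * z * y)"
    by (metis emb_left_commute mult.assoc)
  also have "\<dots> \<asymp> emb (qpow t) * (emb (qpow s) * (z * x) * y)"
    by (intro eqv_multL eqv_multR qcommD assms)
  also have "\<dots> = emb (qpow (s + t)) * (z * (x * y))"
    by (simp add: emb_qpow_add mult.assoc) (metis emb_commute mult.assoc)
  finally show ?thesis by (simp add: qcomm_def)
qed

lemma qcomm_multR:
  assumes "qcomm s x y" "qcomm t x z"
  shows "qcomm (s + t) x (y * z)"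
proof -
  have "x * (y * z) = x * y * z"
    by (simp add: mult.assoc)
  also have "\<dots> \<asymp> emb (qpow s) * (y * x) * z"
    by (intro eqv_multR qcommD assms)
  also have "\<dots> = emb (qpow s) * (y * (x * z))"
    by (simp add: mult.assoc)
  also have "\<dots> \<asymp> emb (qpow s) * (y * (emb (qpow t) * (z * x)))"
    by (intro eqv_multL qcommD assms)
  also have "\<dots> = emb (qpow (s + t)) * (y * z * x)"
    by (simp add: emb_qpow_add mult.assoc) (metis emb_left_commute)
  finally show ?thesis by (simp add: qcomm_def)
qed

lemma qcomm_1L [simp]: "qcomm 0 1 x" and qcomm_1R [simp]: "qcomm 0 x 1"
  by (simp_all add: qcomm_def)

lemma qcomm_powerL: "qcomm t x y \<Longrightarrow> qcomm (of_nat n * t) (x ^ n) y"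
  by (induction n) (auto simp: distrib_right intro: qcomm_multL)

lemma qcomm_powerR: "qcomm t x y \<Longrightarrow> qcomm (of_nat n * t) x (y ^ n)"
  by (induction n) (auto simp: distrib_right intro: qcomm_multR)

text \<open>\<open>qform s x T y\<close>: up to the factor \<open>q\<^sup>s\<close>, \<open>y\<close> has the normal form \<open>x T\<close> with the Cartan part
  \<open>T\<close> moved to the right.\<close>

definition qform :: "complex \<Rightarrow> 'x free_alg fps \<Rightarrow> 'x free_alg fps \<Rightarrow> 'x free_alg fps \<Rightarrow> bool" where
  "qform s x T y \<longleftrightarrow> y \<asymp> emb (qpow s) * (x * T)"

lemma qformD: "qform s x T y \<Longrightarrow> y \<asymp> emb (qpow s) * (x * T)"
  by (simp add: qform_def)

lemma qform_1 [simp]: "qform 0 1 1 1" and qform_self: "qform 0 x T (x * T)"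
  by (simp_all add: qform_def)

lemma qform_qcomm: "qcomm t T x \<Longrightarrow> qform t x T (T * x)"
  by (simp add: qform_def qcomm_def)

text \<open>The only reordering is to move \<open>T\<close> past \<open>x'\<close>, which costs the
  exponent \<open>t\<close>.\<close>

lemma qform_mult:
  assumes "qform s x T y" "qform s' x' T' y'" "qcomm t T x'"
  shows "qform (s + s' + t) (x * x') (T * T') (y * y')"
proof -
  have "y * y' \<asymp> (emb (qpow s) * (x * T)) * (emb (qpow s') * (x' * T'))"
    by (intro eqv_mult qformD assms)
  also have "\<dots> = emb (qpow (s + s')) * (x * (T * x') * T')"
    by (simp add: emb_qpow_add mult.assoc) (metis emb_left_commute mult.assoc)
  also have "\<dots> \<asymp> emb (qpow (s + s')) * (x * (emb (qpow t) * (x' * T)) * T')"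
    by (intro eqv_multL eqv_multR qcommD assms)
  also have "\<dots> = emb (qpow (s + s' + t)) * (x * x' * (T * T'))"
    by (simp add: emb_qpow_add[of "s + s'"] mult.assoc) (metis emb_left_commute mult.assoc)
  finally show ?thesis by (simp add: qform_def)
qed

text \<open>\<open>n choose 2\<close> counts the pairs of factors in which a \<open>T\<close> has to
  pass a later \<open>x\<close>.\<close>

lemma qform_power:
  assumes "qform s x T y" "qcomm t T x"
  shows "qform (of_nat n * s + of_nat (n choose 2) * t) (x ^ n) (T ^ n) (y ^ n)"
proof (induction n)
  case (Suc n)
  from qform_mult[OF assms(1) this qcomm_powerR[OF assms(2), of n]] show ?case
    by (simp add: algebra_simps numeral_2_eq_2)
qed (simp add: numeral_2_eq_2)

lemma qform_eqv: "qform s x T y \<Longrightarrow> T \<asymp> T' \<Longrightarrow> qform s x T' y"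
  unfolding qform_def by (erule eqv_trans) (intro eqv_multL)

text \<open>Every pair of factors \<open>x * T\<close> contributes \<open>t\<close>, wherever
  \<open>x'\<close> stands. Only crossings with the middle factor depend on \<open>r\<close>:
  \<open>m - r\<close> copies of \<open>T\<close> pass \<open>x'\<close>, and \<open>T'\<close>
  passes \<open>r\<close> copies of \<open>x\<close>, which costs
  \<open>(m - r) u + r v\<close>.\<close>

lemma qform_serre_monomial:
  assumes "qform s x T y" "qform s' x' T' y'" "qcomm t T x" "qcomm u T x'" "qcomm v T' x" "qcomm 0 T' T"
    and "r \<le> m"
  shows "qform (of_nat m * s + s' + of_nat (m choose 2) * t + of_nat m * u - of_nat r * (u - v))
    (x ^ (m - r) * x' * x ^ r) (T ^ m * T') (y ^ (m - r) * y' * y ^ r)"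
proof -
  obtain p where m: "m = p + r" using assms(7) by (metis le_add_diff_inverse2)
  have "qcomm (of_nat p * (of_nat r * t) + of_nat r * v) (T ^ p * T') (x ^ r)"
    by (intro qcomm_multL qcomm_powerL qcomm_powerR assms)
  note * = qform_mult[OF qform_mult[OF qform_power[OF assms(1,3), of p] assms(2) qcomm_powerL[OF assms(4), of p]]
      qform_power[OF assms(1,3), of r] this]
  \<comment> \<open>The Cartan part first comes out as \<open>T ^ p * T' * T ^ r\<close>; it has to
    be the same for all \<open>r\<close>.\<close>
  have "T' * T ^ r \<asymp> T ^ r * T'"
    using qcomm_powerR[OF assms(6), of r] by (simp add: qcomm_def)
  then have "T ^ p * T' * T ^ r \<asymp> T ^ m * T'"
    unfolding m power_add mult.assoc by (rule eqv_multL)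
  from qform_eqv[OF * this]
  have "qform (of_nat p * s + of_nat (p choose 2) * t + s' + of_nat p * u + (of_nat r * s + of_nat (r choose 2) * t) +
      (of_nat p * (of_nat r * t) + of_nat r * v)) (x ^ p * x' * x ^ r) (T ^ m * T') (y ^ p * y' * y ^ r)" .
  \<comment> \<open>Pairs among \<open>p + r\<close> factors lie within the first \<open>p\<close>,
    within the last \<open>r\<close>, or across.\<close>
  moreover have "m choose 2 = (p choose 2) + (r choose 2) + p * r"
    unfolding m by (induction r) (simp_all add: numeral_2_eq_2)
  ultimately show ?thesis by (simp add: m algebra_simps)
qed

end

lemma emb_fps_const_sum: "emb (fps_const (sum f A)) = (\<Sum>i\<in>A. emb (fps_const (f i)))"
  by (simp add: emb_fps_const fps_eq_iff fps_sum_nth cst_sum)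

section \<open>Weights and Cartan exponentials\<close>

locale cartan_congruence = closed_congruence J
  for J :: "'i::finite generator free_alg fps set" +
  assumes gH_commute: "\<And>i j. gH i * gH j \<asymp> gH j * gH i"
begin

definition has_weight :: "('i \<Rightarrow> complex) \<Rightarrow> 'i generator free_alg fps \<Rightarrow> bool" where
  "has_weight \<mu> x \<longleftrightarrow> (\<forall>j. gH j * x \<asymp> x * gH j + emb (fps_const (\<mu> j)) * x)"

lemma has_weight_mult:
  assumes "has_weight \<mu> x" "has_weight \<nu> y"
  shows "has_weight (\<lambda>j. \<mu> j + \<nu> j) (x * y)"
  unfolding has_weight_def
proof
  fix j
  have "gH j * (x * y) \<asymp> (x * gH j + emb (fps_const (\<mu> j)) * x) * y"
    unfolding mult.assoc[symmetric] using assms(1) by (intro eqv_multR) (simp add: has_weight_def)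
  also have "\<dots> = x * (gH j * y) + emb (fps_const (\<mu> j)) * (x * y)"
    by (simp add: distrib_right mult.assoc)
  also have "\<dots> \<asymp> x * (y * gH j + emb (fps_const (\<nu> j)) * y) + emb (fps_const (\<mu> j)) * (x * y)"
    using assms(2) by (intro eqv_add eqv_multL) (simp_all add: has_weight_def)
  also have "\<dots> = x * y * gH j + emb (fps_const (\<mu> j + \<nu> j)) * (x * y)"
    unfolding fps_const_add[symmetric] emb_add distrib_left distrib_right emb_left_commute[of x]
    by (simp add: mult.assoc add_ac)
  finally show "gH j * (x * y) \<asymp> x * y * gH j + emb (fps_const (\<mu> j + \<nu> j)) * (x * y)" .
qed

lemma has_weight_lin:
  assumes "has_weight \<mu> x"
  shows "fps_const (lin z) * x \<asymp> x * fps_const (lin z + cst (\<Sum>j\<in>UNIV. z j * \<mu> j))"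
proof -
  let ?z = "\<lambda>j. emb (fps_const (z j)) :: 'i generator free_alg fps"
  have lin: "fps_const (lin z) = (\<Sum>j\<in>UNIV. ?z j * gH j)"
    by (simp add: lin_def gen_fps_def emb_fps_const fps_eq_iff fps_sum_nth)
  have "fps_const (lin z) * x = (\<Sum>j\<in>UNIV. ?z j * (gH j * x))"
    by (simp add: lin sum_distrib_right mult.assoc)
  also have "\<dots> \<asymp> (\<Sum>j\<in>UNIV. ?z j * (x * gH j + emb (fps_const (\<mu> j)) * x))"
    using assms by (intro eqv_sum eqv_multL) (simp add: has_weight_def)
  also have "\<dots> = (\<Sum>j\<in>UNIV. x * (?z j * gH j + emb (fps_const (z j * \<mu> j))))"
    by (intro sum.cong refl)
      (simp add: distrib_left emb_left_commute[of x] emb_commute[of _ x, symmetric] emb_mult mult.assoc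
        flip: fps_const_mult)
  also have "\<dots> = x * (fps_const (lin z) + emb (fps_const (\<Sum>j\<in>UNIV. z j * \<mu> j)))"
    by (simp add: lin sum.distrib emb_fps_const_sum flip: sum_distrib_left)
  finally show ?thesis by (simp add: emb_fps_const)
qed

text \<open>Moving \<open>lin z\<close> past \<open>x\<close> adds a constant to it, hence also
  inside every power and inside the exponential. The constant is central, so its exponential splits
  off as a power of q.\<close>

lemma has_weight_hexp:
  assumes "has_weight \<mu> x"
  shows "qcomm (\<Sum>j\<in>UNIV. z j * \<mu> j) (hexp (lin z)) x"
proof -
  let ?w = "\<Sum>j\<in>UNIV. z j * \<mu> j"
  have power: "fps_const (lin z ^ n) * x \<asymp> x * fps_const ((lin z + cst ?w) ^ n)" for n
  proof (induction n)
    case (Suc n)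
    have "fps_const (lin z ^ Suc n) * x = fps_const (lin z) * (fps_const (lin z ^ n) * x)"
      by (simp flip: mult.assoc)
    also have "\<dots> \<asymp> fps_const (lin z) * (x * fps_const ((lin z + cst ?w) ^ n))"
      by (intro eqv_multL Suc)
    also have "\<dots> = (fps_const (lin z) * x) * fps_const ((lin z + cst ?w) ^ n)"
      by (simp add: mult.assoc)
    also have "\<dots> \<asymp> x * fps_const (lin z + cst ?w) * fps_const ((lin z + cst ?w) ^ n)"
      by (intro eqv_multR has_weight_lin assms)
    also have "\<dots> = x * fps_const ((lin z + cst ?w) ^ Suc n)"
      by (simp add: mult.assoc)
    finally show ?case .
  qed simp
  have "hexp (lin z) * x \<asymp> x * hexp (lin z + cst ?w)"
  proof (rule eqv_fps)
    fix n
    have nth: "fps_const (fps_nth (hexp u) n) = emb (fps_const (1 / fact n)) * fps_const (u ^ n)"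
      for u :: "'i generator free_alg"
      by (simp add: hexp_def emb_fps_const)
    show "fps_const (fps_nth (hexp (lin z)) n) * x \<asymp> x * fps_const (fps_nth (hexp (lin z + cst ?w)) n)"
      unfolding nth mult.assoc emb_left_commute[of x] by (intro eqv_multL power)
  qed
  also have "x * hexp (lin z + cst ?w) = x * hexp (lin z) * emb (qpow ?w)"
    by (simp only: hexp_add[OF cst_commute[symmetric]] hexp_cst mult.assoc)
  also have "\<dots> = emb (qpow ?w) * (x * hexp (lin z))"
    by (rule emb_commute[symmetric])
  finally show ?thesis by (simp add: qcomm_def)
qed

lemma has_weight_hprod:
  assumes "has_weight \<mu> x"
  shows "qcomm (\<Sum>z\<leftarrow>zs. \<Sum>j\<in>UNIV. z j * \<mu> j) (hprod zs) x"
  by (induction zs) (auto intro: qcomm_multL has_weight_hexp assms)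

lemma has_weight_gH: "has_weight (\<lambda>_. 0) (gH i)"
  using gH_commute by (simp add: has_weight_def)

text \<open>Each \<open>gH j\<close> itself has weight 0, so the Cartan exponentials commute with
  it; this is read with the roles exchanged. Consequently a Cartan factor does not change the weight
  of a generator.\<close>

lemma has_weight_0_hprod: "has_weight (\<lambda>_. 0) (hprod zs)"
  unfolding has_weight_def
proof
  fix j
  have "hprod zs * gH j \<asymp> gH j * hprod zs"
    using has_weight_hprod[OF has_weight_gH, of zs j] by (simp add: qcomm_def sum_list_triv)
  then show "gH j * hprod zs \<asymp> hprod zs * gH j + emb (fps_const 0) * hprod zs"
    by (simp add: eqv_sym)
qed

lemma hprod_commute: "qcomm 0 (hprod ys) (hprod zs)"
  using has_weight_hprod[OF has_weight_0_hprod, of ys zs] by (simp add: sum_list_triv)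

text \<open>Here the negated factors stand in the original order, as in the image of
  \<open>gF i\<close>, so unlike \<open>hprod_rev_neg\<close> this rests on commutation of
  exponentials modulo \<open>J\<close>.\<close>

lemma hprod_neg: "hprod zs * hprod (map neg zs) \<asymp> 1"
proof (induction zs)
  case (Cons z zs)
  have "hexp (lin (neg z)) = hprod [neg z]" by simp
  then have "hprod zs * hexp (lin (neg z)) \<asymp> hexp (lin (neg z)) * hprod zs"
    using hprod_commute[of zs "[neg z]"] by (simp add: qcomm_def)
  then have "hexp (lin z) * (hprod zs * hexp (lin (neg z))) * hprod (map neg zs) \<asymp>
      hexp (lin z) * (hexp (lin (neg z)) * hprod zs) * hprod (map neg zs)"
    by (intro eqv_multL eqv_multR)
  also have "\<dots> = hexp (lin z) * hexp (lin (neg z)) * (hprod zs * hprod (map neg zs))"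
    by (simp add: mult.assoc)
  also have "\<dots> \<asymp> 1"
    using Cons by (simp add: hexp_lin_neg)
  finally show ?case by (simp add: mult.assoc)
qed simp

end

section \<open>Twisting the quantum group relations\<close>

context closed_congruence
begin

text \<open>The power of q in the normal form of a term contains \<open>- r (u - v)\<close>, which
  the coefficient \<open>g r\<close> compensates. What is left is the given relation, up to a
  scalar, times \<open>T ^ m * T'\<close>.\<close>

lemma twisted_serre_sum:
  assumes "qform s x T y" "qform s' x' T' y'" "qcomm t T x" "qcomm u T x'" "qcomm v T' x" "qcomm 0 T' T"
    and rel: "(\<Sum>r\<le>m. f r *h (x ^ (m - r) * x' * x ^ r)) \<in> J"
    and fg: "\<And>r. g r = f r * qpow (of_nat r * (u - v))"
  shows "(\<Sum>r\<le>m. g r *h (y ^ (m - r) * y' * y ^ r)) \<in> J"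
proof -
  define e where "e = of_nat m * s + s' + of_nat (m choose 2) * t + of_nat m * u"
  have "(\<Sum>r\<le>m. g r *h (y ^ (m - r) * y' * y ^ r)) \<asymp>
      (\<Sum>r\<le>m. emb (g r) * (emb (qpow (e - of_nat r * (u - v))) * (x ^ (m - r) * x' * x ^ r * (T ^ m * T'))))"
    unfolding scal_emb e_def
    by (intro eqv_sum eqv_multL qformD qform_serre_monomial assms(1-6)) simp
  also have "\<dots> = (\<Sum>r\<le>m. emb (qpow e) * (f r *h (x ^ (m - r) * x' * x ^ r)) * (T ^ m * T'))"
  proof (intro sum.cong refl)
    fix r
    have "g r * qpow (e - of_nat r * (u - v)) = f r * qpow (of_nat r * (u - v) + (e - of_nat r * (u - v)))"
      unfolding fg qpow_def fps_exp_add_mult by (simp only: mult.assoc)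
    then have "g r * qpow (e - of_nat r * (u - v)) = qpow e * f r"
      by (simp add: mult.commute)
    then have "emb (g r) * emb (qpow (e - of_nat r * (u - v))) =
        emb (qpow e) * (emb (f r) :: 'x free_alg fps)"
      by (simp only: emb_mult[symmetric])
    then show "emb (g r) * (emb (qpow (e - of_nat r * (u - v))) * (x ^ (m - r) * x' * x ^ r * (T ^ m * T'))) =
        emb (qpow e) * (f r *h (x ^ (m - r) * x' * x ^ r)) * (T ^ m * T')"
      unfolding scal_emb mult.assoc[symmetric] by simp
  qed
  also have "\<dots> = emb (qpow e) * (\<Sum>r\<le>m. f r *h (x ^ (m - r) * x' * x ^ r)) * (T ^ m * T')"
    by (simp only: sum_distrib_left sum_distrib_right)
  finally show ?thesis
    by (rule eqv_mem) (intro closed_idealD(3,4)[OF closed] rel)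
qed

end

text \<open>For \<open>F i\<close> the list is negated but not reversed, to match the prescribed
  order of the factors in the image of \<open>f\<^sub>i\<close>.\<close>

primrec twist :: "('i::finite \<Rightarrow> ('i \<Rightarrow> complex) list) \<Rightarrow> 'i generator \<Rightarrow> 'i generator free_alg fps" where
  "twist zs (E i) = gE i * hprod (zs i)"
| "twist zs (F i) = hprod (map neg (zs i)) * gF i"
| "twist zs (Hgen i) = gH i"

text \<open>If \<open>a j k\<close> is the value of \<alpha>_k on H_j, this is the value of
  \<alpha>_k on the sum of the Cartan elements listed in \<open>zs i\<close>: the exponent with
  which \<open>hprod (zs i)\<close> q-commutes with \<open>gE k\<close>.\<close>

definition twist_exp :: "('i::finite \<Rightarrow> 'i \<Rightarrow> int) \<Rightarrow> ('i \<Rightarrow> ('i \<Rightarrow> complex) list) \<Rightarrow> 'i \<Rightarrow> 'i \<Rightarrow> complex" where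
  "twist_exp a zs i k = (\<Sum>z\<leftarrow>zs i. \<Sum>j\<in>UNIV. z j * of_int (a j k))"

lemma sum_list_map_neg:
  "(\<Sum>z\<leftarrow>map neg zs. \<Sum>j\<in>UNIV. z j * w j) = - (\<Sum>z\<leftarrow>zs. \<Sum>j\<in>UNIV. z j * (w j :: complex))"
  by (induction zs) (simp_all add: neg_def sum_negf)

lemma sum_list_map_minus:
  "(\<Sum>z\<leftarrow>zs. \<Sum>j\<in>UNIV. z j * - w j) = - (\<Sum>z\<leftarrow>zs. \<Sum>j\<in>UNIV. z j * (w j :: complex))"
  by (induction zs) (simp_all add: sum_negf)

lemma
  shows Uhs_rels_HH: "gH i * gH j - gH j * gH i \<in> Uhs_rels a d c"
    and Uhs_rels_HE: "gH i * gE j - gE j * gH i - of_int (a i j) *h gE j \<in> Uhs_rels a d c"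
    and Uhs_rels_HF: "gH i * gF j - gF j * gH i + of_int (a i j) *h gF j \<in> Uhs_rels a d c"
    and Uhs_rels_EF: "gE i * gF j - qpow (- c i j) *h (gF j * gE i) - (if i = j then Kquot d i else 0)
       \<in> Uhs_rels a d c"
    and Uhs_rels_EE: "i \<noteq> j \<Longrightarrow> (\<Sum>r\<le>nat (1 - a i j).
         ((-1) ^ r * qpow (of_nat r * c i j) * q_binom (qi d i) (nat (1 - a i j)) r) *h
         (gE i ^ (nat (1 - a i j) - r) * gE j * gE i ^ r)) \<in> Uhs_rels a d c"
    and Uhs_rels_FF: "i \<noteq> j \<Longrightarrow> (\<Sum>r\<le>nat (1 - a i j).
         ((-1) ^ r * qpow (of_nat r * c i j) * q_binom (qi d i) (nat (1 - a i j)) r) *h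
         (gF i ^ (nat (1 - a i j) - r) * gF j * gF i ^ r)) \<in> Uhs_rels a d c"
  unfolding Uhs_rels_def by blast+

text \<open>Each image is put in normal form modulo \<open>J\<close> and compared with the same
  relation for \<open>c'\<close>. The relations with \<open>gH i\<close> persist because Cartan
  factors have weight 0.\<close>

lemma (in cartan_congruence) subst_hom_twist_rels:
  assumes J: "\<And>y. y \<in> Uhs_rels a d c' \<Longrightarrow> y \<in> J"
    and c: "\<And>i j. c i j = c' i j + twist_exp a zs i j - twist_exp a zs j i"
    and x: "x \<in> Uhs_rels a d c"
  shows "subst_hom (twist zs) x \<in> J"
proof -
  define T where "T i = hprod (zs i)" for i
  define T' where "T' i = hprod (map neg (zs i))" for i
  define t where "t = twist_exp a zs"
  define \<Phi> where "\<Phi> = subst_hom (twist zs)"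
  have wE: "has_weight (\<lambda>j. of_int (a j k)) (gE k)" for k
    using J[OF Uhs_rels_HE] by (auto simp: has_weight_def eqv_def scal_emb fps_of_int diff_diff_add)
  have wF: "has_weight (\<lambda>j. - of_int (a j k)) (gF k)" for k
    using J[OF Uhs_rels_HF]
    by (auto simp: has_weight_def eqv_def scal_emb fps_of_int emb_minus algebra_simps simp flip: fps_const_neg)
  have TE: "qcomm (t i k) (T i) (gE k)" for i k
    using has_weight_hprod[OF wE[of k], of "zs i"] by (simp add: t_def T_def twist_exp_def)
  have TF: "qcomm (- t i k) (T i) (gF k)" for i k
    using has_weight_hprod[OF wF[of k], of "zs i"] unfolding sum_list_map_minus
    by (simp add: t_def T_def twist_exp_def)
  have T'E: "qcomm (- t i k) (T' i) (gE k)" for i k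
    using has_weight_hprod[OF wE[of k], of "map neg (zs i)"] unfolding sum_list_map_neg
    by (simp add: t_def T'_def twist_exp_def)
  have T'F: "qcomm (t i k) (T' i) (gF k)" for i k
    using has_weight_hprod[OF wF[of k], of "map neg (zs i)"] unfolding sum_list_map_neg sum_list_map_minus
    by (simp add: t_def T'_def twist_exp_def)
  have TT: "qcomm 0 (T i) (T j)" "qcomm 0 (T' i) (T' j)" "qcomm 0 (T' i) (T j)" for i j
    by (simp_all add: T_def T'_def hprod_commute)
  have hom: "cont_hom \<Phi>" by (simp add: \<Phi>_def cont_hom_subst_hom)
  have \<Phi>E: "\<Phi> (gE i) = gE i * T i" and \<Phi>F: "\<Phi> (gF i) = T' i * gF i" and \<Phi>H: "\<Phi> (gH i) = gH i" for i
    by (simp_all add: \<Phi>_def subst_hom_gen T_def T'_def)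
  note \<Phi> = cont_hom_sum[OF hom] cont_hom_diff[OF hom] cont_hom_add[OF hom] cont_hom_mult[OF hom]
    cont_hom_emb[OF hom] cont_hom_power[OF hom] cont_hom_0[OF hom] cont_hom_Kquot[OF hom \<Phi>H] \<Phi>E \<Phi>F \<Phi>H
  have c: "c i j = c' i j + t i j - t j i" for i j
    by (simp add: c t_def)
  consider (HH) i j where "x = gH i * gH j - gH j * gH i"
    | (HE) i j where "x = gH i * gE j - gE j * gH i - of_int (a i j) *h gE j"
    | (HF) i j where "x = gH i * gF j - gF j * gH i + of_int (a i j) *h gF j"
    | (EF) i j where "x = gE i * gF j - qpow (- c i j) *h (gF j * gE i) - (if i = j then Kquot d i else 0)"
    | (EE) i j where "i \<noteq> j" "x = (\<Sum>r\<le>nat (1 - a i j).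
         ((-1) ^ r * qpow (of_nat r * c i j) * q_binom (qi d i) (nat (1 - a i j)) r) *h
         (gE i ^ (nat (1 - a i j) - r) * gE j * gE i ^ r))"
    | (FF) i j where "i \<noteq> j" "x = (\<Sum>r\<le>nat (1 - a i j).
         ((-1) ^ r * qpow (of_nat r * c i j) * q_binom (qi d i) (nat (1 - a i j)) r) *h
         (gF i ^ (nat (1 - a i j) - r) * gF j * gF i ^ r))"
    using x unfolding Uhs_rels_def by blast
  then have "\<Phi> x \<in> J"
  proof cases
    case HH
    then show ?thesis by (simp add: \<Phi> J Uhs_rels_HH)
  next
    case HE
    have "has_weight (\<lambda>k. of_int (a k j) + 0) (gE j * T j)"
      unfolding T_def by (intro has_weight_mult wE has_weight_0_hprod)
    then have "gH i * (gE j * T j) \<asymp> gE j * T j * gH i + emb (of_int (a i j)) * (gE j * T j)"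
      by (simp add: has_weight_def fps_of_int)
    then show ?thesis by (simp add: HE \<Phi> scal_emb eqv_def diff_diff_add)
  next
    case HF
    have "has_weight (\<lambda>k. 0 + - of_int (a k j)) (T' j * gF j)"
      unfolding T'_def by (intro has_weight_mult wF has_weight_0_hprod)
    then have "gH i * (T' j * gF j) \<asymp> T' j * gF j * gH i - emb (of_int (a i j)) * (T' j * gF j)"
      by (simp add: has_weight_def fps_of_int emb_minus flip: fps_const_neg)
    then show ?thesis by (simp add: HF \<Phi> scal_emb eqv_def algebra_simps)
  next
    case EF
    let ?K = "if i = j then Kquot d i else 0"
    let ?q = "\<lambda>c. emb (qpow c) :: 'i generator free_alg fps"
    \<comment> \<open>Moving \<open>T' j\<close> past \<open>gF j\<close> costs
      \<open>t j j\<close>, moving \<open>T i\<close> past \<open>gF j\<close> costs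
      \<open>- t i j\<close>.\<close>
    have ef: "gE i * T i * (T' j * gF j) \<asymp> ?q (t j j - t i j) * (gE i * gF j * (T i * T' j))"
      using qformD[OF qform_mult[OF qform_self[of "gE i" "T i"] qform_qcomm[OF T'F[of j j]] TF[of i j]]] by simp
    have "T' j * T i \<asymp> T i * T' j"
      using qcommD[OF TT(3)[of j i]] by simp
    from qformD[OF qform_eqv[OF qform_mult[OF qform_qcomm[OF T'F[of j j]] qform_self[of "gE i" "T i"] T'E[of j i]] this]]
    have fe: "T' j * gF j * (gE i * T i) \<asymp> ?q (t j j - t j i) * (gF j * gE i * (T i * T' j))" by simp
    \<comment> \<open>By the choice of \<open>c\<close> a common prefactor can be taken out, and the
      bracket left is the one in the relation for \<open>c'\<close>.\<close>
    have q: "?q (- c i j) * ?q (t j j - t j i) = ?q (t j j - t i j) * ?q (- c' i j)"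
      by (simp add: c algebra_simps flip: emb_qpow_add)
    have "\<Phi> x = gE i * T i * (T' j * gF j) - ?q (- c i j) * (T' j * gF j * (gE i * T i)) - ?K"
      by (simp add: EF \<Phi> scal_emb)
    also have "\<dots> \<asymp> ?q (t j j - t i j) * (gE i * gF j * (T i * T' j)) -
        ?q (- c i j) * (?q (t j j - t j i) * (gF j * gE i * (T i * T' j))) - ?K"
      by (intro eqv_diff eqv_multL ef fe eqv_refl)
    also have "\<dots> = ?q (t j j - t i j) * ((gE i * gF j - ?q (- c' i j) * (gF j * gE i)) * (T i * T' j)) - ?K"
      by (simp add: right_diff_distrib left_diff_distrib q flip: mult.assoc)
    also have "\<dots> \<asymp> ?q (t j j - t i j) * (?K * (T i * T' j)) - ?K"
      using J[OF Uhs_rels_EF[of i j c' d a]]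
      by (intro eqv_diff eqv_multL eqv_multR eqv_refl) (simp add: eqv_def scal_emb)
    also have "\<dots> \<asymp> 0"
    \<comment> \<open>For \<open>i = j\<close> the prefactor is 1 and \<open>T i * T' i\<close> is
      congruent to 1; otherwise \<open>?K\<close> is 0.\<close>
    proof (cases "i = j")
      case True
      have "Kquot d i * (T i * T' i) - Kquot d i \<asymp> Kquot d i * 1 - Kquot d i"
        unfolding T_def T'_def by (intro eqv_diff eqv_multL hprod_neg eqv_refl)
      with True show ?thesis by simp
    qed simp
    finally show ?thesis by (simp add: eqv_def)
  next
    case EE
    \<comment> \<open>Here \<open>u - v\<close> is \<open>t i j - t j i\<close>, which equals
      \<open>c i j - c' i j\<close>.\<close>
    show ?thesis
      unfolding EE(2) scal_emb \<Phi> unfolding scal_emb[symmetric]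
      by (rule twisted_serre_sum[OF qform_self qform_self TE[of i i] TE[of i j] TE[of j i] TT(1) J[OF Uhs_rels_EE[OF EE(1)]]])
        (simp add: c algebra_simps qpow_def flip: fps_exp_add_mult)
  next
    case FF
    \<comment> \<open>The signs from \<open>T'\<close> and from the weight of \<open>gF\<close>
      cancel, so the exponents are those of the case \<open>EE\<close>.\<close>
    show ?thesis
      unfolding FF(2) scal_emb \<Phi> unfolding scal_emb[symmetric]
      by (rule twisted_serre_sum[OF qform_qcomm[OF T'F] qform_qcomm[OF T'F] T'F[of i i] T'F[of i j] T'F[of j i] TT(2)
            J[OF Uhs_rels_FF[OF FF(1)]]])
        (simp add: c algebra_simps qpow_def flip: fps_exp_add_mult)
  qed
  then show ?thesis by (simp add: \<Phi>_def)
qed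

section \<open>From the relations to the isomorphism\<close>

lemma subst_hom_twist_rel_ideal:
  assumes "\<And>i j. c i j = c' i j + twist_exp a zs i j - twist_exp a zs j i" "x \<in> Uhs_rels a d c"
  shows "subst_hom (twist zs) x \<in> rel_ideal (Uhs_rels a d c')"
proof -
  have J: "y \<in> rel_ideal (Uhs_rels a d c')" if "y \<in> Uhs_rels a d c'" for y
    using that rel_ideal_superset by blast
  interpret closed_congruence "rel_ideal (Uhs_rels a d c')"
    by standard (rule closed_ideal_rel_ideal)
  interpret cartan_congruence "rel_ideal (Uhs_rels a d c')"
    by standard (simp add: eqv_def J Uhs_rels_HH)
  show ?thesis using J assms by (rule subst_hom_twist_rels)
qed

text \<open>The second substitution fixes the Cartan factors and supplies their exact inverses, so
  the composition is the identity on generators.\<close>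

lemma subst_hom_twist_inverse:
  "subst_hom (twist (\<lambda>i. rev (map neg (zs i)))) (subst_hom (twist zs) x) = x"
proof -
  let ?\<Psi> = "subst_hom (twist (\<lambda>i. rev (map neg (zs i))))"
  have hprod: "?\<Psi> (hprod ys) = hprod ys" for ys
    by (rule cont_hom_hprod) (simp_all add: cont_hom_subst_hom subst_hom_gen)
  have "?\<Psi> (subst_hom (twist zs) (gen_fps g)) = gen_fps g" for g
  proof (cases g)
    case (E i)
    then show ?thesis
      by (simp add: subst_hom_gen cont_hom_mult[OF cont_hom_subst_hom] hprod mult.assoc hprod_rev_neg')
  next
    case (F i)
    have "map neg (rev (map neg (zs i))) = rev (zs i)" by (simp add: rev_map comp_def)
    with F show ?thesis
      using hprod_rev_neg[of "map neg (zs i)"]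
      by (simp add: subst_hom_gen cont_hom_mult[OF cont_hom_subst_hom] hprod comp_def flip: mult.assoc)
  qed (simp add: subst_hom_gen)
  then show ?thesis
    by (rule cont_hom_ext[OF cont_hom_comp[OF cont_hom_subst_hom cont_hom_subst_hom] cont_hom_id])
qed

text \<open>Reversing and negating the lists changes the sign of every \<open>twist_exp\<close>, so
  the inverse substitution leads from \<open>c'\<close> back to \<open>c\<close>.\<close>

lemma twist_alg_iso:
  assumes "\<And>i j. c i j = c' i j + twist_exp a zs i j - twist_exp a zs j i"
  shows "\<exists>\<psi>\<in>alg_iso (Uhs a d c) (Uhs a d c').
    \<forall>x. \<psi> (cls (Uhs_rels a d c) x) = cls (Uhs_rels a d c') (subst_hom (twist zs) x)"
proof (rule alg_iso_of_inverse_homs)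
  let ?zs = "\<lambda>i. rev (map neg (zs i))"
  have [simp]: "twist_exp a ?zs i j = - twist_exp a zs i j" for i j
    unfolding twist_exp_def sum_list_map_neg[symmetric] by (simp add: rev_map sum_list_rev flip: rev_map)
  show "subst_hom (twist ?zs) (subst_hom (twist zs) x) = x" for x
    by (rule subst_hom_twist_inverse)
  show "subst_hom (twist zs) (subst_hom (twist ?zs) x) = x" for x
    using subst_hom_twist_inverse[of ?zs x] by (simp add: rev_map comp_def)
  show "subst_hom (twist zs) x \<in> rel_ideal (Uhs_rels a d c')" if "x \<in> Uhs_rels a d c" for x
    using assms that by (rule subst_hom_twist_rel_ideal)
  show "subst_hom (twist ?zs) x \<in> rel_ideal (Uhs_rels a d c)" if "x \<in> Uhs_rels a d c'" for x
    using _ that by (rule subst_hom_twist_rel_ideal) (simp add: assms)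
qed (rule cont_hom_subst_hom)+

text \<open>Since \<open>qpow 0\<close> is 1, the untwisted quantum group belongs to the family
  treated by \<open>twist_alg_iso\<close>.\<close>

lemma Uh_rels_eq: "Uh_rels a d = Uhs_rels a d (\<lambda>_ _. 0)"
proof -
  have "(1 :: complex fps) *h x = x" for x :: "'a generator free_alg fps"
    by (simp add: scal_emb)
  then show ?thesis
    by (simp add: Uh_rels_def Uhs_rels_def qpow_def)
qed

section \<open>The Cartan matrix and the main theorem\<close>

context lie_data
begin

section \<open>Nondegeneracy of the Cartan matrix\<close>

lemma simple_root_in_dual: "\<alpha> i \<in> dual_of \<hh>"
  using simple_roots unfolding simple_roots_def root_set_def by blast

text \<open>Elements of \<open>dual_of \<hh>\<close> vanish outside \<hh>, whereas
  \<open>\<alpha> i\<close> takes the value 2 at its coroot.\<close>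

lemma coroot_in_cartan: "H i \<in> \<hh>"
proof (rule ccontr)
  assume "H i \<notin> \<hh>"
  then have "\<alpha> i (H i) = 0" using simple_root_in_dual[of i] unfolding dual_of_def by blast
  with coroots[of i] show False by (simp add: is_coroot_def)
qed

lemma subspace_cartan: "subspace \<hh>"
  using cartan by (simp add: cartan_subalgebra_def lie_subalgebra_def)

lemma B_right_linear:
  "B x (y + z) = B x y + B x z" "B x (k *s y) = k * B x y"
proof -
  interpret L: Vector_Spaces.linear scale "(*)" "\<lambda>y. B y x" by (rule B_linear)
  show "B x (y + z) = B x y + B x z" "B x (k *s y) = k * B x y"
    using L.add[of y z] L.scale[of k y] by (simp_all add: B_symmetric[of x])
qed

lemma B_right_0: "B x 0 = 0"
  using B_right_linear(2)[of x 0 0] by simp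

lemma B_right_sum: "B x (sum f A) = (\<Sum>i\<in>A. B x (f i))"
  by (induction A rule: infinite_finite_induct) (simp_all add: B_right_linear B_right_0)

text \<open>By invariance \<open>B y (br u v) = B (br y u) v\<close>, which is
  \<open>\<alpha> i y * B u v\<close> for a root vector \<open>u\<close>; so pairing with the coroot
  is a multiple of \<open>\<alpha> i\<close>.\<close>

lemma B_coroot:
  assumes "y \<in> \<hh>"
  shows "B y (H i) = \<alpha> i y / of_nat (d i)"
proof -
  have "\<exists>\<kappa>. \<forall>y\<in>\<hh>. B y t = \<kappa> * \<alpha> i y"
    if "t \<in> span {br u v | u v. u \<in> root_space \<hh> (\<alpha> i) \<and> v \<in> root_space \<hh> (\<lambda>z. - \<alpha> i z)}" for t
    using that
  proof (induction rule: span_induct_alt)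
    case base
    show ?case by (rule exI[of _ 0]) (simp add: B_right_0)
  next
    case (step c t s)
    then obtain u v \<kappa> where t: "t = br u v" and u: "u \<in> root_space \<hh> (\<alpha> i)"
      and \<kappa>: "\<forall>y\<in>\<hh>. B y s = \<kappa> * \<alpha> i y" by blast
    have "B y t = B u v * \<alpha> i y" if "y \<in> \<hh>" for y
    proof -
      have "B y t = B (\<alpha> i y *s u) v"
        using u that by (simp add: t root_space_def flip: B_invariant)
      then show ?thesis
        using B_right_linear(2)[of v "\<alpha> i y" u] by (simp add: B_symmetric[of _ v])
    qed
    then have "\<forall>y\<in>\<hh>. B y (c *s t + s) = (c * B u v + \<kappa>) * \<alpha> i y"
      using \<kappa> by (simp add: B_right_linear algebra_simps)
    then show ?case by blast
  qed
  then obtain \<kappa> where \<kappa>: "B y (H i) = \<kappa> * \<alpha> i y" if "y \<in> \<hh>" for y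
    using coroots[of i] unfolding is_coroot_def by blast
  \<comment> \<open>The multiple is determined at \<open>y = H i\<close>, where
    \<open>B_normalized\<close> applies and \<open>a i i\<close> is 2.\<close>
  have "\<alpha> i (H i) = 2" using coroots[of i] by (simp add: is_coroot_def)
  with \<kappa>[OF coroot_in_cartan[of i]] B_normalized[of i i] cartan_matrix[of i i]
  have "2 / of_nat (d i) = \<kappa> * 2" by simp
  then have "\<kappa> * 2 = 1 / of_nat (d i) * 2" by (simp only: times_divide_eq_left mult_1)
  then have "\<kappa> = 1 / of_nat (d i)" unfolding mult_cancel_right by simp
  with \<kappa>[OF assms] show ?thesis by simp
qed

text \<open>The simple roots span the dual space, so a common zero would be annihilated by every
  functional.\<close>

lemma simple_roots_separate:
  assumes "x \<in> \<hh>" "\<And>j. \<alpha> j x = 0"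
  shows "x = 0"
proof (rule ccontr)
  assume "x \<noteq> 0"
  then have ind: "independent {x}" by simp
  define \<B> where "\<B> = extend_basis {x}"
  have \<B>: "independent \<B>" "x \<in> \<B>" "v \<in> span \<B>" for v
    using ind independent_extend_basis[OF ind] extend_basis_superset[OF ind] span_extend_basis[OF ind]
    by (auto simp: \<B>_def)
  \<comment> \<open>The coordinate at \<open>x\<close> in a basis containing \<open>x\<close>, set
    to 0 outside \<hh> as \<open>dual_of\<close> demands.\<close>
  define \<xi> where "\<xi> v = (if v \<in> \<hh> then representation \<B> v x else 0)" for v
  have "\<xi> \<in> dual_of \<hh>"
    using subspace_add[OF subspace_cartan] subspace_scale[OF subspace_cartan]
    by (simp add: dual_of_def \<xi>_def representation_add representation_scale \<B>)
  then obtain k where "\<xi> = (\<lambda>v. \<Sum>i\<in>UNIV. k i * \<alpha> i v)"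
    using simple_roots unfolding simple_roots_def by blast
  then have "\<xi> x = 0" using assms(2) by simp
  moreover have "\<xi> x = 1" using assms(1) representation_basis[OF \<B>(1,2)] by (simp add: \<xi>_def)
  ultimately show False by simp
qed

lemma dual_sum:
  fixes f :: "'b \<Rightarrow> 'g"
  assumes \<xi>: "\<xi> \<in> dual_of \<hh>" and f: "\<And>i. f i \<in> \<hh>"
  shows "\<xi> (\<Sum>i\<in>A. k i *s f i) = (\<Sum>i\<in>A. k i * \<xi> (f i))"
proof (induction A rule: infinite_finite_induct)
  case (insert i A)
  have "k i *s f i \<in> \<hh>" "(\<Sum>i\<in>A. k i *s f i) \<in> \<hh>"
    by (intro subspace_sum subspace_cartan subspace_scale f)+
  with \<xi> insert show ?case by (simp add: dual_of_def f)
next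
  have "0 \<in> \<hh>" by (rule subspace_0[OF subspace_cartan])
  then have "\<xi> (0 + 0) = \<xi> 0 + \<xi> 0" using \<xi> unfolding dual_of_def by blast
  then have "\<xi> 0 = 0" by simp
  then show "\<xi> (\<Sum>i\<in>{}. k i *s f i) = (\<Sum>i\<in>{}. k i * \<xi> (f i))"
    "infinite A \<Longrightarrow> \<xi> (\<Sum>i\<in>A. k i *s f i) = (\<Sum>i\<in>A. k i * \<xi> (f i))" for A
    by simp_all
qed

text \<open>A relation among the rows makes the same combination of coroots a common zero of the
  simple roots, hence 0. Pairing it with \<hh> turns this into a relation among the simple roots
  with coefficients \<open>m i / d i\<close>, and these roots are independent.\<close>

lemma cartan_matrix_rows_independent:
  fixes m :: "'i \<Rightarrow> complex"
  assumes "\<And>j. (\<Sum>i\<in>UNIV. m i * of_int (a i j)) = 0"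
  shows "m i = 0"
proof -
  define x where "x = (\<Sum>i\<in>UNIV. m i *s H i)"
  have x: "x \<in> \<hh>"
    unfolding x_def by (intro subspace_sum subspace_cartan subspace_scale coroot_in_cartan)
  have "\<alpha> j x = (\<Sum>i\<in>UNIV. m i * of_int (a i j))" for j
    unfolding x_def by (simp add: dual_sum[OF simple_root_in_dual coroot_in_cartan] cartan_matrix)
  then have "x = 0"
    using assms by (intro simple_roots_separate x) simp
  have "(\<Sum>i\<in>UNIV. m i / of_nat (d i) * \<alpha> i y) = 0" for y
  proof (cases "y \<in> \<hh>")
    case True
    then have "B y x = (\<Sum>i\<in>UNIV. m i / of_nat (d i) * \<alpha> i y)"
      by (simp add: x_def B_right_sum B_right_linear B_coroot)
    with \<open>x = 0\<close> show ?thesis by (simp add: B_right_0)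
  next
    case False
    then show ?thesis using simple_root_in_dual by (simp add: dual_of_def)
  qed
  then have 1: "(\<lambda>_. 0) = (\<lambda>y. \<Sum>i\<in>UNIV. m i / of_nat (d i) * \<alpha> i y)" by simp
  have 2: "(\<lambda>_. 0) = (\<lambda>y. \<Sum>i\<in>UNIV. 0 * \<alpha> i y)" by simp
  have "(\<lambda>_. 0) \<in> dual_of \<hh>" by (simp add: dual_of_def)
  then have "\<exists>!k. (\<lambda>_. 0) = (\<lambda>x. \<Sum>i\<in>UNIV. k i * \<alpha> i x)"
    using simple_roots unfolding simple_roots_def by blast
  then obtain k\<^sub>0 where k\<^sub>0: "k = k\<^sub>0" if "(\<lambda>_. 0) = (\<lambda>x. \<Sum>i\<in>UNIV. k i * \<alpha> i x)" for k
    by (elim ex1E) blast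
  have "m i / of_nat (d i) = 0"
    using k\<^sub>0[OF 1] k\<^sub>0[OF 2] by metis
  then show ?thesis using d_pos[of i] by simp
qed

text \<open>\<open>matrix_inv\<close> is defined by choice, so invertibility has to come first:
  independent rows give a right inverse, which suffices for a square matrix.\<close>

lemma cartan_matrix_inverse:
  "(\<Sum>j\<in>UNIV. matrix_inv (\<chi> k m. of_int (a k m)) $ p $ j * of_int (a j k)) = (if p = k then 1 else 0 :: complex)"
proof -
  let ?A = "(\<chi> k m. of_int (a k m)) :: complex ^ 'i ^ 'i"
  have "\<exists>C. ?A ** C = mat 1"
    unfolding matrix_right_invertible_independent_rows
  proof (intro allI impI)
    fix m i assume "(\<Sum>i\<in>UNIV. m i *s row i ?A) = 0"
    then have "(\<Sum>i\<in>UNIV. m i * of_int (a i j)) = 0" for j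
      by (simp add: vec_eq_iff row_def)
    then show "m i = 0" by (rule cartan_matrix_rows_independent)
  qed
  then have "invertible ?A" by (simp add: invertible_right_inverse)
  then have "matrix_inv ?A ** ?A = mat 1"
    unfolding invertible_def matrix_inv_def by (rule someI2_ex) blast
  then have "(matrix_inv ?A ** ?A) $ p $ k = mat 1 $ p $ k" by simp
  then show ?thesis by (simp add: matrix_matrix_mult_def mat_def)
qed

end

section \<open>The Cartan factors of the theorem\<close>

lemma sum_list_sorted_UNIV:
  "(\<Sum>p\<leftarrow>sorted_list_of_set UNIV. f p) = (\<Sum>p\<in>UNIV. f (p :: 'i::{finite,linorder}))"
  by (simp add: sum_list_distinct_conv_sum_set)

lemma Lprod_eq_hprod:
  "Lprod a d m = hprod (map (\<lambda>p j. m p * (of_nat (d p) *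
     vec_nth (vec_nth (matrix_inv (\<chi> k m. of_int (a k m))) p) j)) (sorted_list_of_set UNIV))"
  by (simp add: Lprod_def hprod_def comp_def Lpow_def Y_def lin_def sum_distrib_left cst_mult mult.assoc)

theorem theorem4p1:
  fixes scale :: "complex \<Rightarrow> 'g::ab_group_add \<Rightarrow> 'g"
    and br :: "'g \<Rightarrow> 'g \<Rightarrow> 'g"
    and \<hh> :: "'g set"
    and \<alpha> :: "'i::{finite,linorder} \<Rightarrow> 'g \<Rightarrow> complex"
    and H :: "'i \<Rightarrow> 'g"
    and a :: "'i \<Rightarrow> 'i \<Rightarrow> int"
    and d :: "'i \<Rightarrow> nat"
    and B :: "'g \<Rightarrow> 'g \<Rightarrow> complex"
    and s :: "'g \<Rightarrow> 'g"
    and c n :: "'i \<Rightarrow> 'i \<Rightarrow> complex"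
  assumes "lie_data scale br \<hh> \<alpha> H a d B"
    and "s \<in> complex_lie_algebra.weyl_group scale br \<hh>"
    and "c = lie_data.cayley_coeff \<hh> \<alpha> B s"
    and "\<And>i j. of_nat (d j) * n i j - of_nat (d i) * n j i = c i j"
  shows "\<exists>\<psi> \<in> alg_iso (Uhs a d c) (Uh a d). \<forall>i.
      \<psi> (cls (Uhs_rels a d c) (gE i)) = cls (Uh_rels a d) (gE i * Lprod a d (n i)) \<and>
      \<psi> (cls (Uhs_rels a d c) (gF i)) = cls (Uh_rels a d) (Lprod a d (\<lambda>p. - n i p) * gF i) \<and>
      \<psi> (cls (Uhs_rels a d c) (gH i)) = cls (Uh_rels a d) (gH i)"
proof -
  define ai :: "'i \<Rightarrow> 'i \<Rightarrow> complex"
    where "ai p j = vec_nth (vec_nth (matrix_inv (\<chi> k m. of_int (a k m))) p) j" for p j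
  define zs where "zs i = map (\<lambda>p j. n i p * (of_nat (d p) * ai p j)) (sorted_list_of_set UNIV)" for i
  have L: "hprod (zs i) = Lprod a d (n i)" "hprod (map neg (zs i)) = Lprod a d (\<lambda>p. - n i p)" for i
    by (simp_all add: Lprod_eq_hprod zs_def ai_def neg_def comp_def)
  \<comment> \<open>The coordinates of Y_p are \<open>d p * ai p j\<close>, so \<alpha>_k takes the
    value \<open>d p\<close> on Y_p if \<open>p = k\<close> and 0 otherwise; only
    \<open>p = k\<close> survives.\<close>
  have "twist_exp a zs i k = of_nat (d k) * n i k" for i k
  proof -
    have "twist_exp a zs i k = (\<Sum>p\<in>UNIV. n i p * of_nat (d p) * (\<Sum>j\<in>UNIV. ai p j * of_int (a j k)))"
      by (simp add: twist_exp_def zs_def comp_def sum_list_sorted_UNIV sum_distrib_left mult.assoc)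
    also have "\<dots> = (\<Sum>p\<in>UNIV. if p = k then n i p * of_nat (d p) else 0)"
      unfolding ai_def lie_data.cartan_matrix_inverse[OF assms(1)] by (intro sum.cong) auto
    finally show ?thesis by simp
  qed
  \<comment> \<open>With these exponents the assumed equations say that \<open>c i j\<close> is
    \<open>0 + twist_exp a zs i j - twist_exp a zs j i\<close>.\<close>
  then obtain \<psi> where \<psi>: "\<psi> \<in> alg_iso (Uhs a d c) (Uh a d)"
    "\<And>x. \<psi> (cls (Uhs_rels a d c) x) = cls (Uh_rels a d) (subst_hom (twist zs) x)"
    using twist_alg_iso[of c "\<lambda>_ _. 0" a zs d] assms(4) unfolding Uh_rels_eq by auto
  then show ?thesis
    by (intro bexI[of _ \<psi>]) (simp_all add: subst_hom_gen L)
qed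

end
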